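(* Let $\mathrm{char}\,K\neq2$ and let $\lambda,\mu$ be bi-partitions of $r$. If $\lambda\not\trianglerighteq\mu$, then $\mathrm{Hom}_{KW_r}(S(\lambda),S(\mu))=0$.
   Context: $K$ is an algebraically closed field, $r\ge1$, and modules are finite-dimensional right modules. $W_r$ is the hyperoctahedral group: permutations $\sigma$ of $\{\pm1,\dots,\pm r\}$ with $\sigma(-i)=-\sigma(i)$ (acting on the right on symbols); $KW_r$ is its group algebra. Each $\sigma\in W_r$ is uniquely a product of sign changes $\xi_i$ (swapping $i$ and $-i$, fixing the other symbols) times some $\pi\in\mathfrak S_r$; put $\mathrm{sgn}\,\sigma=(-1)^{x}\mathrm{sgn}\,\pi$ with $x$ the number of sign changes. A bi-partition $\lambda=(\lambda^1,\lambda^2)$ of $r$ is a pair of (possibly empty) partitions with $|\lambda^1|+|\lambda^2|=r$. Dominance: $\lambda\trianglerighteq\mu$ iff $\sum_{i\le j}\lambda^1_i\ge\sum_{i\le j}\mu^1_i$ for all $j$ and $|\lambda^1|+\sum_{i\le j}\lambda^2_i\ge|\mu^1|+\sum_{i\le j}\mu^2_i$ for all $j$. A $\lambda$-bi-tableau $t=(t^1,t^2)$ is a filling of the boxes of the Young diagrams of $\lambda^1,\lambda^2$ by elements of $\{\pm1,\dots,\pm r\}$ in which every absolute value $1,\dots,r$ occurs exactly once; $W_r$ acts on bi-tableaux on the right through the entries. $R_t\le W_r$ is the group of elements permuting the entries within each row of $t$, possibly changing signs of entries of $t^2$ (but not of $t^1$); $C_t\le W_r$ is the group of elements permuting the entries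 within each column of $t$, possibly changing signs of entries of $t^1$ (but not of $t^2$). Put $t_1\sim t_2$ if $t_2=t_1\sigma$ for some $\sigma\in R_{t_1}$; the class of $t$ is the bi-tabloid $\{t\}$. The permutation module $M(\lambda)$ is the $K$-space with basis the $\lambda$-bi-tabloids, with action $\{t\}\sigma=\{t\sigma\}$. Put $k_t=\sum_{\sigma\in C_t}(\mathrm{sgn}\,\sigma)\sigma$ and $e_t=\{t\}k_t$. The Specht module $S(\lambda)\subseteq M(\lambda)$ is the span of all $e_t$. *)

theory Defs
  imports
    "HOL-Algebra.Ring"
    "HOL-Combinatorics.Permutations"
    "HOL-Computational_Algebra.Polynomial"
    "HOL-Library.Poly_Mapping"
begin

section \<open>The hyperoctahedral group\<close>

definition signed_symbols :: "nat \<Rightarrow> int set"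
  where "signed_symbols r = {i. i \<noteq> 0 \<and> \<bar>i\<bar> \<le> int r}"

text \<open>The group acts on symbols from the right: the image of \<open>i\<close> under the product of
  \<open>\<sigma>\<close> and \<open>\<tau>\<close> is \<open>\<tau> (\<sigma> i)\<close>.\<close>

definition hyperoct :: "nat \<Rightarrow> (int \<Rightarrow> int) monoid"
  where "hyperoct r =
    \<lparr>carrier = {\<sigma>. \<sigma> permutes signed_symbols r \<and> (\<forall>i\<in>signed_symbols r. \<sigma> (- i) = - \<sigma> i)},
     monoid.mult = (\<lambda>\<sigma> \<tau>. \<tau> \<circ> \<sigma>), one = id\<rparr>"

text \<open>The product of the commuting sign changes \<open>\<xi>\<^sub>i\<close> for \<open>i\<close> in \<open>A\<close>, a set of positive integers.\<close>

definition sign_changes :: "int set \<Rightarrow> int \<Rightarrow> int"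
  where "sign_changes A = (\<lambda>i. if \<bar>i\<bar> \<in> A then - i else i)"

text \<open>The embedding of the symmetric group on \<open>{1..int r}\<close> into \<open>hyperoct r\<close>.\<close>

definition signed_extension :: "(int \<Rightarrow> int) \<Rightarrow> int \<Rightarrow> int"
  where "signed_extension \<pi> = (\<lambda>i. if i < 0 then - \<pi> (- i) else \<pi> i)"

text \<open>Existence and uniqueness of the decomposition below, hence the meaning of the description, are
  the lemmas \<open>hyperoct_decomposition\<close> and \<open>hsgn_eq\<close>.\<close>

definition hsgn :: "nat \<Rightarrow> (int \<Rightarrow> int) \<Rightarrow> int"
  where "hsgn r \<sigma> = (THE s. \<exists>A \<pi>. A \<subseteq> {1..int r} \<and> \<pi> permutes {1..int r} \<and>
    \<sigma> = sign_changes A \<otimes>\<^bsub>hyperoct r\<^esub> signed_extension \<pi> \<and> s = (- 1) ^ card A * sign \<pi>)"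

lemma hyperoct_uminus:
  assumes "\<sigma> \<in> carrier (hyperoct r)"
  shows "\<sigma> (- i) = - \<sigma> i"
proof (cases "i \<in> signed_symbols r")
  case True
  then show ?thesis using assms by (simp add: hyperoct_def)
next
  case False
  then have "- i \<notin> signed_symbols r" by (simp add: signed_symbols_def)
  moreover have "\<sigma> permutes signed_symbols r" using assms by (simp add: hyperoct_def)
  ultimately show ?thesis using permutes_not_in[of \<sigma> "signed_symbols r"] False by metis
qed

lemma hyperoct_zero: "\<sigma> \<in> carrier (hyperoct r) \<Longrightarrow> \<sigma> 0 = 0"
  using hyperoct_uminus[of \<sigma> r 0] by simp

lemma hyperoct_inv_closed:
  assumes s: "\<sigma> \<in> carrier (hyperoct r)"
  shows "inv_into UNIV \<sigma> \<in> carrier (hyperoct r)"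
proof -
  from s have p: "\<sigma> permutes signed_symbols r" by (simp add: hyperoct_def)
  have "inv_into UNIV \<sigma> (- i) = - inv_into UNIV \<sigma> i" for i
    by (metis hyperoct_uminus[OF s] p permutes_inverses(1) permutes_inverses(2))
  then show ?thesis
    using permutes_inv[OF p] by (simp add: hyperoct_def)
qed

lemma hyperoct_group: "group (hyperoct r)"
proof (rule groupI)
  fix \<sigma> assume s: "\<sigma> \<in> carrier (hyperoct r)"
  then have p: "\<sigma> permutes signed_symbols r" by (simp add: hyperoct_def)
  have "inv_into UNIV \<sigma> \<otimes>\<^bsub>hyperoct r\<^esub> \<sigma> = \<one>\<^bsub>hyperoct r\<^esub>"
    using permutes_inv_o(1)[OF p] by (simp add: hyperoct_def)
  then show "\<exists>\<tau>\<in>carrier (hyperoct r). \<tau> \<otimes>\<^bsub>hyperoct r\<^esub> \<sigma> = \<one>\<^bsub>hyperoct r\<^esub>"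
    using hyperoct_inv_closed[OF s] by blast
next
  fix \<sigma> \<tau> assume s: "\<sigma> \<in> carrier (hyperoct r)" "\<tau> \<in> carrier (hyperoct r)"
  then show "\<sigma> \<otimes>\<^bsub>hyperoct r\<^esub> \<tau> \<in> carrier (hyperoct r)"
    using hyperoct_uminus[OF s(1)] hyperoct_uminus[OF s(2)]
    by (auto simp: hyperoct_def intro: permutes_compose)
qed (auto simp: hyperoct_def comp_assoc)

lemma hyperoct_decomposition:
  assumes s: "\<sigma> \<in> carrier (hyperoct r)"
  shows "\<exists>A \<pi>. A \<subseteq> {1..int r} \<and> \<pi> permutes {1..int r} \<and>
    \<sigma> = sign_changes A \<otimes>\<^bsub>hyperoct r\<^esub> signed_extension \<pi>"
proof -
  define A where "A = {i \<in> {1..int r}. \<sigma> i < 0}"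
  define \<pi> where "\<pi> = (\<lambda>i. if i \<in> {1..int r} then \<bar>\<sigma> i\<bar> else i)"
  have p: "\<sigma> permutes signed_symbols r" using s by (simp add: hyperoct_def)
  note m = hyperoct_uminus[OF s]
  have range: "\<bar>\<sigma> i\<bar> \<in> {1..int r}" if "i \<in> {1..int r}" for i
    using permutes_in_image[OF p, of i] that by (auto simp: signed_symbols_def)
  have inj: "inj_on \<pi> {1..int r}"
  proof (rule inj_onI)
    fix i j assume ij: "i \<in> {1..int r}" "j \<in> {1..int r}" "\<pi> i = \<pi> j"
    then have "\<sigma> i = \<sigma> j \<or> \<sigma> i = \<sigma> (- j)" by (auto simp: \<pi>_def abs_eq_iff m)
    then have "i = j \<or> i = - j" using permutes_inj[OF p] by (auto dest: injD)
    then show "i = j" using ij by auto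
  qed
  have "\<pi> ` {1..int r} \<subseteq> {1..int r}" using range by (auto simp: \<pi>_def)
  then have "bij_betw \<pi> {1..int r} {1..int r}"
    using inj by (simp add: bij_betw_def endo_inj_surj)
  then have perm: "\<pi> permutes {1..int r}"
    by (rule bij_imp_permutes) (auto simp: \<pi>_def)
  have "\<sigma> i = signed_extension \<pi> (sign_changes A i)" for i
  proof (cases "i \<in> signed_symbols r")
    case True
    then consider "i \<in> {1..int r}" | "- i \<in> {1..int r}" "i < 0"
      by (fastforce simp: signed_symbols_def)
    then show ?thesis
    proof cases
      case 1 then show ?thesis
        by (auto simp: signed_extension_def sign_changes_def A_def \<pi>_def)
    next
      case 2 then show ?thesis using m[of i] range[of "- i"]
        by (auto simp: signed_extension_def sign_changes_def A_def \<pi>_def)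
    qed
  next
    case False
    then have "\<sigma> i = i" using permutes_not_in[OF p] by blast
    then show ?thesis using False
      by (auto simp: signed_extension_def sign_changes_def A_def \<pi>_def signed_symbols_def)
  qed
  then have "\<sigma> = sign_changes A \<otimes>\<^bsub>hyperoct r\<^esub> signed_extension \<pi>"
    by (auto simp: hyperoct_def)
  moreover have "A \<subseteq> {1..int r}" by (auto simp: A_def)
  ultimately show ?thesis using perm by blast
qed

lemma decomposition_unique:
  assumes A: "A \<subseteq> {1..int r}" "\<pi> permutes {1..int r}"
    and s: "\<sigma> = sign_changes A \<otimes>\<^bsub>hyperoct r\<^esub> signed_extension \<pi>"
  shows "A = {i \<in> {1..int r}. \<sigma> i < 0}" "\<pi> = (\<lambda>i. if i \<in> {1..int r} then \<bar>\<sigma> i\<bar> else i)"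
proof -
  have r: "\<pi> i \<ge> 1" if "i \<in> {1..int r}" for i
    using permutes_in_image[OF A(2), of i] that by auto
  have v: "\<sigma> i = (if i \<in> A then - \<pi> i else \<pi> i)" if "i \<in> {1..int r}" for i
    using that by (auto simp: s hyperoct_def sign_changes_def signed_extension_def)
  show "A = {i \<in> {1..int r}. \<sigma> i < 0}"
  proof (rule Set.set_eqI)
    fix i
    show "i \<in> A \<longleftrightarrow> i \<in> {i \<in> {1..int r}. \<sigma> i < 0}"
      using A(1) r[of i] v[of i] by (cases "i \<in> {1..int r}") auto
  qed
  show "\<pi> = (\<lambda>i. if i \<in> {1..int r} then \<bar>\<sigma> i\<bar> else i)"
  proof
    fix i
    show "\<pi> i = (if i \<in> {1..int r} then \<bar>\<sigma> i\<bar> else i)"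
      using r[of i] v[of i] permutes_not_in[OF A(2), of i] by (cases "i \<in> {1..int r}") auto
  qed
qed

lemma hsgn_eq:
  assumes "A \<subseteq> {1..int r}" "\<pi> permutes {1..int r}"
  shows "hsgn r (sign_changes A \<otimes>\<^bsub>hyperoct r\<^esub> signed_extension \<pi>) = (- 1) ^ card A * sign \<pi>"
  unfolding hsgn_def
proof (rule the_equality)
  let ?\<sigma> = "sign_changes A \<otimes>\<^bsub>hyperoct r\<^esub> signed_extension \<pi>"
  fix s assume "\<exists>B \<rho>. B \<subseteq> {1..int r} \<and> \<rho> permutes {1..int r} \<and>
    ?\<sigma> = sign_changes B \<otimes>\<^bsub>hyperoct r\<^esub> signed_extension \<rho> \<and> s = (- 1) ^ card B * sign \<rho>"
  then obtain B \<rho> where B: "B \<subseteq> {1..int r}" "\<rho> permutes {1..int r}"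
    "?\<sigma> = sign_changes B \<otimes>\<^bsub>hyperoct r\<^esub> signed_extension \<rho>" "s = (- 1) ^ card B * sign \<rho>" by blast
  have "B = A" "\<rho> = \<pi>"
    using decomposition_unique[OF B(1-3)] decomposition_unique[OF assms refl] by simp_all
  then show "s = (- 1) ^ card A * sign \<pi>" using B(4) by simp
next
  show "\<exists>B \<rho>. B \<subseteq> {1..int r} \<and> \<rho> permutes {1..int r} \<and>
    sign_changes A \<otimes>\<^bsub>hyperoct r\<^esub> signed_extension \<pi> =
      sign_changes B \<otimes>\<^bsub>hyperoct r\<^esub> signed_extension \<rho> \<and>
    (- 1) ^ card A * sign \<pi> = (- 1) ^ card B * sign \<rho>"
    by (intro exI conjI) (rule assms refl)+
qed


section \<open>Free modules and the group algebra\<close>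

text \<open>The \<open>K\<close>-space with basis \<open>B\<close> is the set of finitely supported \<open>x :: 'b \<Rightarrow>\<^sub>0 'k\<close> whose
  support \<open>Poly_Mapping.keys x\<close> lies in \<open>B\<close>.\<close>

definition fscale :: "'k::field \<Rightarrow> ('b \<Rightarrow>\<^sub>0 'k) \<Rightarrow> ('b \<Rightarrow>\<^sub>0 'k)"
  where "fscale c = Poly_Mapping.map ((*) c)"

text \<open>The bilinear extension of an operation on basis elements.\<close>

definition bilin :: "('a \<Rightarrow> 'b \<Rightarrow> 'c) \<Rightarrow> ('a \<Rightarrow>\<^sub>0 'k::field) \<Rightarrow> ('b \<Rightarrow>\<^sub>0 'k) \<Rightarrow> ('c \<Rightarrow>\<^sub>0 'k)"
  where "bilin f x y = (\<Sum>a\<in>Poly_Mapping.keys x. \<Sum>b\<in>Poly_Mapping.keys y.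
    Poly_Mapping.single (f a b) (Poly_Mapping.lookup x a * Poly_Mapping.lookup y b))"

definition group_algebra :: "nat \<Rightarrow> ((int \<Rightarrow> int) \<Rightarrow>\<^sub>0 'k::field) ring"
  where "group_algebra r =
    \<lparr>carrier = {a. Poly_Mapping.keys a \<subseteq> carrier (hyperoct r)},
     monoid.mult = bilin (\<lambda>\<sigma> \<tau>. \<sigma> \<otimes>\<^bsub>hyperoct r\<^esub> \<tau>), one = Poly_Mapping.single (\<one>\<^bsub>hyperoct r\<^esub>) 1,
     ring.zero = 0, add = (+)\<rparr>"

lemma lookup_fscale [simp]: "Poly_Mapping.lookup (fscale c x) b = c * Poly_Mapping.lookup x b"
  by (simp add: fscale_def Poly_Mapping.map.rep_eq when_def)

global_interpretation free: vector_space "fscale :: 'k::field \<Rightarrow> ('b \<Rightarrow>\<^sub>0 'k) \<Rightarrow> _"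
  defines free_span = free.span
  by unfold_locales (auto intro!: poly_mapping_eqI simp: lookup_add algebra_simps)

lemma bilin_superset:
  assumes "finite A" "finite B" "Poly_Mapping.keys x \<subseteq> A" "Poly_Mapping.keys y \<subseteq> B"
  shows "bilin f x y = (\<Sum>a\<in>A. \<Sum>b\<in>B.
    Poly_Mapping.single (f a b) (Poly_Mapping.lookup x a * Poly_Mapping.lookup y b))"
proof -
  have "bilin f x y = (\<Sum>a\<in>Poly_Mapping.keys x. \<Sum>b\<in>B.
    Poly_Mapping.single (f a b) (Poly_Mapping.lookup x a * Poly_Mapping.lookup y b))"
    unfolding bilin_def using assms
    by (intro sum.cong refl sum.mono_neutral_left) (auto simp: in_keys_iff)
  also have "\<dots> = (\<Sum>a\<in>A. \<Sum>b\<in>B.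
    Poly_Mapping.single (f a b) (Poly_Mapping.lookup x a * Poly_Mapping.lookup y b))"
    using assms by (intro sum.mono_neutral_left) (auto simp: in_keys_iff)
  finally show ?thesis .
qed

lemma bilin_add_left: "bilin f (x + x') y = bilin f x y + bilin f x' y"
proof -
  let ?A = "Poly_Mapping.keys x \<union> Poly_Mapping.keys x'"
  have "Poly_Mapping.keys (x + x') \<subseteq> ?A" by (rule keys_add)
  then show ?thesis
    by (simp add: bilin_superset[of ?A "Poly_Mapping.keys y"] lookup_add distrib_right single_add
        sum.distrib)
qed

lemma bilin_add_right: "bilin f x (y + y') = bilin f x y + bilin f x y'"
proof -
  let ?B = "Poly_Mapping.keys y \<union> Poly_Mapping.keys y'"
  have "Poly_Mapping.keys (y + y') \<subseteq> ?B" by (rule keys_add)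
  then show ?thesis
    by (simp add: bilin_superset[of "Poly_Mapping.keys x" ?B] lookup_add distrib_left single_add
        sum.distrib)
qed

lemma bilin_zero [simp]: "bilin f 0 y = 0" "bilin f x 0 = 0"
  by (simp_all add: bilin_def)

lemma bilin_single [simp]:
  "bilin f (Poly_Mapping.single a c) (Poly_Mapping.single b d) = Poly_Mapping.single (f a b) (c * d)"
  by (simp add: bilin_superset[of "{a}" "{b}"])

lemma poly_mapping_add_induct [case_names zero single add]:
  assumes "P 0" "\<And>a c. P (Poly_Mapping.single a c)" "\<And>x y. P x \<Longrightarrow> P y \<Longrightarrow> P (x + y)"
  shows "P (x :: 'a \<Rightarrow>\<^sub>0 'k::field)"
proof -
  have "P (\<Sum>a\<in>A. Poly_Mapping.single a (Poly_Mapping.lookup x a))" if "finite A" for A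
    using that by induction (auto intro: assms)
  moreover have "x = (\<Sum>a\<in>Poly_Mapping.keys x. Poly_Mapping.single a (Poly_Mapping.lookup x a))"
    by (rule poly_mapping_eqI)
       (simp add: lookup_sum lookup_single when_def sum.delta in_keys_iff)
  ultimately show ?thesis using finite_keys by metis
qed

lemma bilin_assoc:
  assumes "\<And>a b c. f (g a b) c = h a (k b c)"
  shows "bilin f (bilin g x y) z = bilin h x (bilin k y z)"
proof (induction x rule: poly_mapping_add_induct)
  case (single a c)
  show ?case
  proof (induction y rule: poly_mapping_add_induct)
    case (single b d)
    show ?case by (induction z rule: poly_mapping_add_induct)
      (simp_all add: bilin_add_left bilin_add_right assms mult.assoc)
  qed (simp_all add: bilin_add_left bilin_add_right)
qed (simp_all add: bilin_add_left bilin_add_right)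

lemma keys_bilin: "Poly_Mapping.keys (bilin f x y) \<subseteq>
  (\<lambda>(a, b). f a b) ` (Poly_Mapping.keys x \<times> Poly_Mapping.keys y)"
  unfolding bilin_def by (rule subsetI, drule subsetD[OF keys_sum], clarsimp,
      drule subsetD[OF keys_sum]) (auto split: if_splits)

lemma ring_group_algebra: "ring (group_algebra r :: ((int \<Rightarrow> int) \<Rightarrow>\<^sub>0 'k::field) ring)"
proof (rule ringI)
  interpret W: group "hyperoct r" by (rule hyperoct_group)
  show "abelian_group (group_algebra r :: ((int \<Rightarrow> int) \<Rightarrow>\<^sub>0 'k::field) ring)"
  proof (rule abelian_groupI)
    fix x :: "(int \<Rightarrow> int) \<Rightarrow>\<^sub>0 'k" assume "x \<in> carrier (group_algebra r)"
    then show "\<exists>y\<in>carrier (group_algebra r). y \<oplus>\<^bsub>group_algebra r\<^esub> x = \<zero>\<^bsub>group_algebra r\<^esub>"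
      by (intro bexI[of _ "- x"]) (auto simp: group_algebra_def in_keys_iff)
  qed (auto simp: group_algebra_def add_ac dest!: subsetD[OF keys_add])
  show "monoid (group_algebra r :: ((int \<Rightarrow> int) \<Rightarrow>\<^sub>0 'k::field) ring)"
  proof (rule monoidI)
    fix x y :: "(int \<Rightarrow> int) \<Rightarrow>\<^sub>0 'k"
    assume "x \<in> carrier (group_algebra r)" "y \<in> carrier (group_algebra r)"
    then show "x \<otimes>\<^bsub>group_algebra r\<^esub> y \<in> carrier (group_algebra r)"
      by (fastforce simp: group_algebra_def dest!: subsetD[OF keys_bilin])
  next
    fix x y z :: "(int \<Rightarrow> int) \<Rightarrow>\<^sub>0 'k"
    show "x \<otimes>\<^bsub>group_algebra r\<^esub> y \<otimes>\<^bsub>group_algebra r\<^esub> z =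
      x \<otimes>\<^bsub>group_algebra r\<^esub> (y \<otimes>\<^bsub>group_algebra r\<^esub> z)"
      unfolding group_algebra_def
      by simp (rule bilin_assoc, simp add: hyperoct_def comp_assoc)
    show "\<one>\<^bsub>group_algebra r\<^esub> \<otimes>\<^bsub>group_algebra r\<^esub> x = x"
      by (induction x rule: poly_mapping_add_induct)
         (simp_all add: group_algebra_def bilin_add_right hyperoct_def)
    show "x \<otimes>\<^bsub>group_algebra r\<^esub> \<one>\<^bsub>group_algebra r\<^esub> = x"
      by (induction x rule: poly_mapping_add_induct)
         (simp_all add: group_algebra_def bilin_add_left hyperoct_def)
  qed (auto simp: group_algebra_def)
qed (auto simp: group_algebra_def bilin_add_left bilin_add_right)


section \<open>Bi-partitions and bi-tableaux\<close>

definition is_partition :: "nat list \<Rightarrow> bool"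
  where "is_partition p \<longleftrightarrow> sorted_wrt (\<ge>) p \<and> 0 \<notin> set p"

type_synonym bipartition = "nat list \<times> nat list"

definition bipartitions :: "nat \<Rightarrow> bipartition set"
  where "bipartitions r = {(p, q). is_partition p \<and> is_partition q \<and> sum_list p + sum_list q = r}"

definition dominates :: "bipartition \<Rightarrow> bipartition \<Rightarrow> bool"  (infix \<open>\<unrhd>\<close> 50)
  where "l \<unrhd> m \<longleftrightarrow>
    (\<forall>j. sum_list (take j (fst l)) \<ge> sum_list (take j (fst m))) \<and>
    (\<forall>j. sum_list (fst l) + sum_list (take j (snd l)) \<ge> sum_list (fst m) + sum_list (take j (snd m)))"

text \<open>Rows and columns are numbered from 0.\<close>

definition diagram :: "nat list \<Rightarrow> (nat \<times> nat) set"
  where "diagram p = {(i, j). i < length p \<and> j < p ! i}"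

type_synonym box = "(nat \<times> nat) + (nat \<times> nat)"

definition boxes :: "bipartition \<Rightarrow> box set"
  where "boxes l = diagram (fst l) <+> diagram (snd l)"

text \<open>The two components of a bi-tableau \<open>t\<close> are \<open>t \<circ> Inl\<close> and \<open>t \<circ> Inr\<close>. Since 0 is not a symbol,
  it serves as the value outside the diagrams, and every element of the group fixes it.\<close>

type_synonym bitableau = "box \<Rightarrow> int"

definition bitableaux :: "nat \<Rightarrow> bipartition \<Rightarrow> bitableau set"
  where "bitableaux r l = {t. bij_betw (\<lambda>b. \<bar>t b\<bar>) (boxes l) {1..int r} \<and> (\<forall>b. b \<notin> boxes l \<longrightarrow> t b = 0)}"

definition tableau_act :: "bitableau \<Rightarrow> (int \<Rightarrow> int) \<Rightarrow> bitableau"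
  where "tableau_act t \<sigma> = \<sigma> \<circ> t"

definition row_entries :: "nat list \<Rightarrow> (nat \<times> nat \<Rightarrow> int) \<Rightarrow> nat \<Rightarrow> int set"
  where "row_entries p u i = {u (i, j) |j. (i, j) \<in> diagram p}"

definition col_entries :: "nat list \<Rightarrow> (nat \<times> nat \<Rightarrow> int) \<Rightarrow> nat \<Rightarrow> int set"
  where "col_entries p u j = {u (i, j) |i. (i, j) \<in> diagram p}"

definition pm :: "int set \<Rightarrow> int set"
  where "pm A = A \<union> uminus ` A"

definition row_group :: "nat \<Rightarrow> bipartition \<Rightarrow> bitableau \<Rightarrow> (int \<Rightarrow> int) set"
  where "row_group r l t = {\<sigma> \<in> carrier (hyperoct r).
    (\<forall>i. \<sigma> ` row_entries (fst l) (t \<circ> Inl) i = row_entries (fst l) (t \<circ> Inl) i) \<and>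
    (\<forall>i. \<sigma> ` pm (row_entries (snd l) (t \<circ> Inr) i) = pm (row_entries (snd l) (t \<circ> Inr) i))}"

definition col_group :: "nat \<Rightarrow> bipartition \<Rightarrow> bitableau \<Rightarrow> (int \<Rightarrow> int) set"
  where "col_group r l t = {\<sigma> \<in> carrier (hyperoct r).
    (\<forall>j. \<sigma> ` pm (col_entries (fst l) (t \<circ> Inl) j) = pm (col_entries (fst l) (t \<circ> Inl) j)) \<and>
    (\<forall>j. \<sigma> ` col_entries (snd l) (t \<circ> Inr) j = col_entries (snd l) (t \<circ> Inr) j)}"


section \<open>Permutation modules and Specht modules\<close>

definition row_equiv :: "nat \<Rightarrow> bipartition \<Rightarrow> (bitableau \<times> bitableau) set"
  where "row_equiv r l = {(s, t). s \<in> bitableaux r l \<and> t \<in> bitableaux r l \<and>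
    (\<exists>\<sigma>\<in>row_group r l s. t = tableau_act s \<sigma>)}"

type_synonym bitabloid = "bitableau set"

definition tabloid :: "nat \<Rightarrow> bipartition \<Rightarrow> bitableau \<Rightarrow> bitabloid"
  where "tabloid r l t = row_equiv r l `` {t}"

definition bitabloids :: "nat \<Rightarrow> bipartition \<Rightarrow> bitabloid set"
  where "bitabloids r l = bitableaux r l // row_equiv r l"

text \<open>The lemma \<open>tabloid_act_tabloid\<close> shows that this is the action of the group on bi-tabloids
  induced by its action on representatives.\<close>

definition tabloid_act :: "bitabloid \<Rightarrow> (int \<Rightarrow> int) \<Rightarrow> bitabloid"
  where "tabloid_act T \<sigma> = (\<lambda>t. tableau_act t \<sigma>) ` T"

definition perm_module :: "nat \<Rightarrow> bipartition \<Rightarrow> (bitabloid \<Rightarrow>\<^sub>0 'k::field) set"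
  where "perm_module r l = {x. Poly_Mapping.keys x \<subseteq> bitabloids r l}"

definition act :: "(bitabloid \<Rightarrow>\<^sub>0 'k::field) \<Rightarrow> ((int \<Rightarrow> int) \<Rightarrow>\<^sub>0 'k) \<Rightarrow> (bitabloid \<Rightarrow>\<^sub>0 'k)"
  where "act = bilin tabloid_act"

definition col_antisym :: "nat \<Rightarrow> bipartition \<Rightarrow> bitableau \<Rightarrow> ((int \<Rightarrow> int) \<Rightarrow>\<^sub>0 'k::field)"
  where "col_antisym r l t = (\<Sum>\<sigma>\<in>col_group r l t. Poly_Mapping.single \<sigma> (of_int (hsgn r \<sigma>)))"

definition polytabloid :: "nat \<Rightarrow> bipartition \<Rightarrow> bitableau \<Rightarrow> (bitabloid \<Rightarrow>\<^sub>0 'k::field)"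
  where "polytabloid r l t = act (Poly_Mapping.single (tabloid r l t) 1) (col_antisym r l t)"

definition Specht :: "nat \<Rightarrow> bipartition \<Rightarrow> (bitabloid \<Rightarrow>\<^sub>0 'k::field) set"
  where "Specht r l = free_span (polytabloid r l ` bitableaux r l)"

text \<open>Homomorphisms of right modules over the group algebra between submodules \<open>U\<close> and \<open>V\<close> of
  permutation modules. Linearity over \<open>K\<close> is the case where \<open>a\<close> is a scalar multiple of the
  identity. Homomorphisms are extended by 0 outside \<open>U\<close>, so that equal homomorphisms are equal
  as functions.\<close>

definition Hom_W :: "nat \<Rightarrow> (bitabloid \<Rightarrow>\<^sub>0 'k::field) set \<Rightarrow> (bitabloid \<Rightarrow>\<^sub>0 'k) set
    \<Rightarrow> ((bitabloid \<Rightarrow>\<^sub>0 'k) \<Rightarrow> (bitabloid \<Rightarrow>\<^sub>0 'k)) set"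
  where "Hom_W r U V = {f.
    (\<forall>x\<in>U. f x \<in> V) \<and> (\<forall>x. x \<notin> U \<longrightarrow> f x = 0) \<and>
    (\<forall>x\<in>U. \<forall>y\<in>U. f (x + y) = f x + f y) \<and>
    (\<forall>x\<in>U. \<forall>a\<in>carrier (group_algebra r). f (act x a) = act (f x) a)}"

lemma hyperoct_inj: "\<sigma> \<in> carrier (hyperoct r) \<Longrightarrow> inj \<sigma>"
  by (auto simp: hyperoct_def intro: permutes_inj)

lemma tableau_act_closed:
  assumes t: "t \<in> bitableaux r l" and s: "\<sigma> \<in> carrier (hyperoct r)"
  shows "tableau_act t \<sigma> \<in> bitableaux r l"
proof -
  have p: "\<sigma> permutes signed_symbols r" using s by (simp add: hyperoct_def)
  have "\<bar>\<sigma> x\<bar> = \<bar>\<sigma> \<bar>x\<bar>\<bar>" for x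
    using hyperoct_uminus[OF s, of x] by (cases "x \<ge> 0") auto
  then have eq: "(\<lambda>b. \<bar>tableau_act t \<sigma> b\<bar>) = (\<lambda>x. \<bar>\<sigma> x\<bar>) \<circ> (\<lambda>b. \<bar>t b\<bar>)"
    by (simp add: fun_eq_iff tableau_act_def)
  have "(\<lambda>x. \<bar>\<sigma> x\<bar>) ` {1..int r} \<subseteq> {1..int r}"
  proof (rule image_subsetI)
    fix x assume "x \<in> {1..int r}"
    then show "\<bar>\<sigma> x\<bar> \<in> {1..int r}"
      using permutes_in_image[OF p, of x] by (auto simp: signed_symbols_def)
  qed
  moreover have "inj_on (\<lambda>x. \<bar>\<sigma> x\<bar>) {1..int r}"
  proof (rule inj_onI)
    fix i j assume ij: "i \<in> {1..int r}" "j \<in> {1..int r}" "\<bar>\<sigma> i\<bar> = \<bar>\<sigma> j\<bar>"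
    then have "\<sigma> i = \<sigma> j \<or> \<sigma> i = \<sigma> (- j)" by (auto simp: abs_eq_iff hyperoct_uminus[OF s])
    then have "i = j \<or> i = - j" using hyperoct_inj[OF s] by (auto dest: injD)
    then show "i = j" using ij by auto
  qed
  ultimately have "bij_betw (\<lambda>x. \<bar>\<sigma> x\<bar>) {1..int r} {1..int r}"
    by (simp add: bij_betw_def endo_inj_surj)
  with t have "bij_betw (\<lambda>b. \<bar>tableau_act t \<sigma> b\<bar>) (boxes l) {1..int r}"
    unfolding bitableaux_def eq by (blast intro: bij_betw_trans)
  then show ?thesis
    using t hyperoct_zero[OF s] by (simp add: bitableaux_def tableau_act_def)
qed

lemma row_entries_act:
  "row_entries p (tableau_act t \<sigma> \<circ> g) i = \<sigma> ` row_entries p (t \<circ> g) i"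
  by (auto simp: row_entries_def tableau_act_def)

lemma pm_image: "\<sigma> \<in> carrier (hyperoct r) \<Longrightarrow> pm (\<sigma> ` A) = \<sigma> ` pm A"
  by (force simp: pm_def image_Un image_image hyperoct_uminus)

lemma row_group_conj:
  assumes s: "\<sigma> \<in> carrier (hyperoct r)" and q: "\<rho> \<in> row_group r l t"
  shows "\<sigma> \<circ> \<rho> \<circ> inv_into UNIV \<sigma> \<in> row_group r l (tableau_act t \<sigma>)"
proof -
  interpret W: group "hyperoct r" by (rule hyperoct_group)
  have p: "\<sigma> permutes signed_symbols r" using s by (simp add: hyperoct_def)
  have i: "inv_into UNIV \<sigma> \<in> carrier (hyperoct r)"
    by (rule hyperoct_inv_closed[OF s])
  have "\<sigma> \<circ> \<rho> \<circ> inv_into UNIV \<sigma> = inv_into UNIV \<sigma> \<otimes>\<^bsub>hyperoct r\<^esub> (\<rho> \<otimes>\<^bsub>hyperoct r\<^esub> \<sigma>)"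
    by (simp add: hyperoct_def)
  then have c: "\<sigma> \<circ> \<rho> \<circ> inv_into UNIV \<sigma> \<in> carrier (hyperoct r)"
    using s q i by (simp add: row_group_def)
  have "(\<sigma> \<circ> \<rho> \<circ> inv_into UNIV \<sigma>) ` \<sigma> ` A = \<sigma> ` \<rho> ` A" for A
    by (simp add: image_image permutes_inverses(2)[OF p])
  then show ?thesis using q c
    by (simp add: row_group_def row_entries_act pm_image[OF s])
qed

lemma row_equiv_act:
  assumes s: "\<sigma> \<in> carrier (hyperoct r)" and q: "(t, u) \<in> row_equiv r l"
  shows "(tableau_act t \<sigma>, tableau_act u \<sigma>) \<in> row_equiv r l"
proof -
  from q obtain \<rho> where r: "\<rho> \<in> row_group r l t" "u = tableau_act t \<rho>"
    and tu: "t \<in> bitableaux r l" "u \<in> bitableaux r l" by (auto simp: row_equiv_def)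
  have p: "\<sigma> permutes signed_symbols r" using s by (simp add: hyperoct_def)
  have "tableau_act u \<sigma> = tableau_act (tableau_act t \<sigma>) (\<sigma> \<circ> \<rho> \<circ> inv_into UNIV \<sigma>)"
    by (simp add: r(2) tableau_act_def fun_eq_iff permutes_inverses(2)[OF p])
  then show ?thesis
    using row_group_conj[OF s r(1)] tableau_act_closed[OF tu(1) s] tableau_act_closed[OF tu(2) s]
    unfolding row_equiv_def by blast
qed

lemma tabloid_act_tabloid:
  assumes s: "\<sigma> \<in> carrier (hyperoct r)"
  shows "tabloid_act (tabloid r l t) \<sigma> = tabloid r l (tableau_act t \<sigma>)"
proof
  show "tabloid_act (tabloid r l t) \<sigma> \<subseteq> tabloid r l (tableau_act t \<sigma>)"
  proof
    fix u assume "u \<in> tabloid_act (tabloid r l t) \<sigma>"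
    then obtain v where v: "(t, v) \<in> row_equiv r l" "u = tableau_act v \<sigma>"
      unfolding tabloid_act_def tabloid_def by blast
    show "u \<in> tabloid r l (tableau_act t \<sigma>)"
      unfolding tabloid_def v(2) by (rule ImageI[OF row_equiv_act[OF s v(1)]]) simp
  qed
  let ?\<tau> = "inv_into UNIV \<sigma>"
  have p: "\<sigma> permutes signed_symbols r" using s by (simp add: hyperoct_def)
  have inverse: "tableau_act (tableau_act u \<sigma>) ?\<tau> = u" "tableau_act (tableau_act u ?\<tau>) \<sigma> = u" for u
    by (simp_all add: tableau_act_def fun_eq_iff permutes_inverses[OF p])
  show "tabloid r l (tableau_act t \<sigma>) \<subseteq> tabloid_act (tabloid r l t) \<sigma>"
  proof
    fix u assume "u \<in> tabloid r l (tableau_act t \<sigma>)"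
    then have "(tableau_act t \<sigma>, u) \<in> row_equiv r l" by (simp add: tabloid_def)
    from row_equiv_act[OF hyperoct_inv_closed[OF s] this]
    have "tableau_act u ?\<tau> \<in> tabloid r l t" by (simp add: inverse tabloid_def)
    then show "u \<in> tabloid_act (tabloid r l t) \<sigma>"
      unfolding tabloid_act_def by (rule image_eqI[rotated]) (simp add: inverse)
  qed
qed

lemma act_closed:
  assumes "x \<in> perm_module r l" "a \<in> carrier (group_algebra r)"
  shows "act x a \<in> perm_module r l"
proof -
  have "tabloid_act T \<sigma> \<in> bitabloids r l"
    if "T \<in> bitabloids r l" "\<sigma> \<in> carrier (hyperoct r)" for T \<sigma>
  proof -
    obtain t where "t \<in> bitableaux r l" "T = tabloid r l t"
      using \<open>T \<in> bitabloids r l\<close> by (auto simp: bitabloids_def tabloid_def elim: quotientE)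
    then show ?thesis
      using tabloid_act_tabloid[OF that(2), of l t] tableau_act_closed[OF _ that(2), of t l]
      by (simp add: bitabloids_def tabloid_def quotientI)
  qed
  then show ?thesis
    using assms unfolding perm_module_def act_def group_algebra_def
    by (fastforce dest!: subsetD[OF keys_bilin])
qed

lemma act_mult: "act (act x a) b = act x (a \<otimes>\<^bsub>group_algebra r\<^esub> b)"
  unfolding act_def group_algebra_def
  by simp (rule bilin_assoc, simp add: tabloid_act_def tableau_act_def hyperoct_def image_image comp_assoc)

lemma act_scalar: "act x (Poly_Mapping.single (\<one>\<^bsub>hyperoct r\<^esub>) c) = fscale c x"
proof (induction x rule: poly_mapping_add_induct)
  case (single a d)
  have "fscale c (Poly_Mapping.single a d) = Poly_Mapping.single a (d * c)"
    by (rule poly_mapping_eqI) (simp add: lookup_single when_def)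
  moreover have "tabloid_act a id = a" by (simp add: tabloid_act_def tableau_act_def)
  ultimately show ?case
    by (simp add: act_def hyperoct_def del: id_apply flip: id_def)
qed (simp_all add: act_def bilin_add_left free.scale_right_distrib)

end

theory Submission
  imports Defs
begin

text \<open>Let \<open>v\<close> be the image of a polytabloid \<open>e\<^sub>t\<close> of shape \<open>l\<close> under a homomorphism, and suppose \<open>v \<noteq> 0\<close>.
  The relations between \<open>e\<^sub>t\<close> and its translates pass to \<open>v\<close>, and a non-zero element of the Specht
  module of \<open>m\<close> can satisfy them only if \<open>l \<unrhd> m\<close> (\<open>dominates_of_col_antisymmetric\<close>).

  An element \<open>\<sigma>\<close> of the column group of \<open>t\<close> with sign \<open>- 1\<close> negates \<open>e\<^sub>t\<close>, hence \<open>v\<close>. So a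
  bi-tabloid \<open>T\<close> fixed by such a \<open>\<sigma>\<close> has a coefficient in \<open>v\<close> equal to its own negative, which is 0
  because the characteristic is not 2. Take \<open>T = {s}\<close> with non-zero coefficient. Then the column
  group of \<open>t\<close> and the row group of \<open>s\<close> have no common element of sign \<open>- 1\<close>. Applied to single sign
  changes, this says that the entries of \<open>t\<^sup>1\<close>, up to sign, all lie in \<open>s\<^sup>1\<close>; applied to signed
  transpositions, it says that two entries in one column of \<open>t\<^sup>1\<close> (or \<open>t\<^sup>2\<close>) never lie in one row of
  \<open>s\<^sup>1\<close> (or \<open>s\<^sup>2\<close>).

  This bounds the first component in the wrong direction. The reverse bound comes from \<open>v\<close> lying not
  just in the permutation module but in the Specht module, which is spanned by simultaneous
  eigenvectors of the sign changes: \<open>\<xi>\<^sub>a\<close> acts on \<open>e\<^sub>s\<close> as \<open>- 1\<close> if \<open>a\<close> occurs in \<open>s\<^sup>1\<close> and as \<open>1\<close> if it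
  occurs in \<open>s\<^sup>2\<close>. Since \<open>v\<close> is fixed by \<open>\<xi>\<^sub>a\<close> for all \<open>a\<close> in \<open>t\<^sup>2\<close>, and 2 is invertible, \<open>v\<close> is a combination of
  those \<open>e\<^sub>s\<close> for which no entry of \<open>t\<^sup>2\<close> occurs in \<open>s\<^sup>1\<close> (\<open>Specht_sign_change_invariant\<close>). As \<open>v \<noteq> 0\<close>, such an
  \<open>s\<close> exists, so the first component of \<open>m\<close> has at most as many boxes as that of \<open>l\<close>.

  Both components of \<open>t\<close> and of \<open>s\<close> therefore have the same entries up to sign. Counting, column by
  column of \<open>t\<close>, the entries in the first \<open>j\<close> rows of \<open>s\<close> gives dominance in each component
  (\<open>partial_sums_le_of_row_col_transversal\<close>), and the two together give \<open>l \<unrhd> m\<close>.\<close>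

section \<open>Row and column groups as block stabilizers\<close>

definition blocks_stabilizer :: "nat \<Rightarrow> int set set \<Rightarrow> (int \<Rightarrow> int) set"
  where "blocks_stabilizer r F = {\<sigma> \<in> carrier (hyperoct r). \<forall>A\<in>F. \<sigma> ` A = A}"

text \<open>With \<open>c = fst\<close> the lines are the rows of a component, with \<open>c = snd\<close> its columns. Row and
  column groups differ only in this choice and in which component may change signs, so treating the
  lines as sets of boxes allows one argument to serve both groups.\<close>

definition lines_fst :: "(nat \<times> nat \<Rightarrow> nat) \<Rightarrow> bipartition \<Rightarrow> box set set"
  where "lines_fst c l = range (\<lambda>k. Inl ` {d \<in> diagram (fst l). c d = k})"

definition lines_snd :: "(nat \<times> nat \<Rightarrow> nat) \<Rightarrow> bipartition \<Rightarrow> box set set"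
  where "lines_snd c l = range (\<lambda>k. Inr ` {d \<in> diagram (snd l). c d = k})"

text \<open>\<open>P\<close> holds the lines within which signs may change, \<open>N\<close> those within which they may not.\<close>

definition entry_blocks :: "bitableau \<Rightarrow> box set set \<Rightarrow> box set set \<Rightarrow> int set set"
  where "entry_blocks t P N = (\<lambda>B. pm (t ` B)) ` P \<union> (\<lambda>B. t ` B) ` N"

lemma row_entries_eq: "row_entries p (t \<circ> g) i = t ` g ` {d \<in> diagram p. fst d = i}"
  by (force simp: row_entries_def)

lemma col_entries_eq: "col_entries p (t \<circ> g) j = t ` g ` {d \<in> diagram p. snd d = j}"
  by (force simp: col_entries_def)

lemma row_group_eq:
  "row_group r l t = blocks_stabilizer r (entry_blocks t (lines_snd fst l) (lines_fst fst l))"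
  unfolding row_group_def row_entries_eq blocks_stabilizer_def entry_blocks_def
    lines_fst_def lines_snd_def ball_Un ball_simps ball_UNIV by (simp only: conj_commute)

lemma col_group_eq:
  "col_group r l t = blocks_stabilizer r (entry_blocks t (lines_fst snd l) (lines_snd snd l))"
  unfolding col_group_def col_entries_eq blocks_stabilizer_def entry_blocks_def
    lines_fst_def lines_snd_def ball_Un ball_simps ball_UNIV by (rule refl)

lemma hyperoct_comp:
  "\<sigma> \<in> carrier (hyperoct r) \<Longrightarrow> \<tau> \<in> carrier (hyperoct r) \<Longrightarrow> \<tau> \<circ> \<sigma> \<in> carrier (hyperoct r)"
  using group.is_monoid[OF hyperoct_group, THEN monoid.m_closed, of \<sigma> r \<tau>]
  by (simp add: hyperoct_def)

lemma finite_hyperoct: "finite (carrier (hyperoct r))"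
proof -
  have "signed_symbols r \<subseteq> {- int r..int r}" by (auto simp: signed_symbols_def)
  then have "finite {\<sigma>. \<sigma> permutes signed_symbols r}"
    by (intro finite_permutations finite_subset[OF _ finite_atLeastAtMost_int])
  then show ?thesis by (rule rev_finite_subset) (auto simp: hyperoct_def)
qed

lemma finite_blocks_stabilizer: "finite (blocks_stabilizer r F)"
  by (rule finite_subset[OF _ finite_hyperoct]) (auto simp: blocks_stabilizer_def)

lemma blocks_stabilizer_comp:
  assumes "\<sigma> \<in> blocks_stabilizer r F" "\<tau> \<in> blocks_stabilizer r F"
  shows "\<tau> \<circ> \<sigma> \<in> blocks_stabilizer r F"
  using assms hyperoct_comp[of \<sigma> r \<tau>] by (simp add: blocks_stabilizer_def image_comp[symmetric] del: comp_apply)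

text \<open>A stabilizer is closed under composition and finite, so translations, being injective, permute it;
  this takes the place of closure under inverses.\<close>

lemma bij_betw_blocks_stabilizer_left:
  assumes s: "\<sigma> \<in> blocks_stabilizer r F"
  shows "bij_betw (\<lambda>\<rho>. \<sigma> \<circ> \<rho>) (blocks_stabilizer r F) (blocks_stabilizer r F)"
proof -
  have "inj \<sigma>" using s hyperoct_inj by (auto simp: blocks_stabilizer_def)
  then have "inj_on (\<lambda>\<rho>. \<sigma> \<circ> \<rho>) (blocks_stabilizer r F)"
    by (auto simp: inj_on_def fun_eq_iff)
  moreover have "(\<lambda>\<rho>. \<sigma> \<circ> \<rho>) ` blocks_stabilizer r F \<subseteq> blocks_stabilizer r F"
    using blocks_stabilizer_comp[OF _ s] by auto
  ultimately show ?thesis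
    by (simp add: bij_betw_def endo_inj_surj finite_blocks_stabilizer)
qed

lemma image_blocks_stabilizer_right:
  assumes s: "\<sigma> \<in> blocks_stabilizer r F"
  shows "(\<lambda>\<rho>. \<rho> \<circ> \<sigma>) ` blocks_stabilizer r F = blocks_stabilizer r F"
proof (rule endo_inj_surj[OF finite_blocks_stabilizer])
  have "\<sigma> permutes signed_symbols r" using s by (simp add: blocks_stabilizer_def hyperoct_def)
  then have "surj \<sigma>" by (rule permutes_surj)
  then show "inj_on (\<lambda>\<rho>. \<rho> \<circ> \<sigma>) (blocks_stabilizer r F)"
    by (auto simp: inj_on_def fun_eq_iff) (metis surjD)
  show "(\<lambda>\<rho>. \<rho> \<circ> \<sigma>) ` blocks_stabilizer r F \<subseteq> blocks_stabilizer r F"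
    using blocks_stabilizer_comp[OF s] by auto
qed

section \<open>The sign character\<close>

definition abs_perm :: "nat \<Rightarrow> (int \<Rightarrow> int) \<Rightarrow> int \<Rightarrow> int"
  where "abs_perm r \<sigma> = (\<lambda>i. if i \<in> {1..int r} then \<bar>\<sigma> i\<bar> else i)"

lemma hyperoct_neq_0:
  assumes "\<sigma> \<in> carrier (hyperoct r)" "i \<noteq> 0"
  shows "\<sigma> i \<noteq> 0"
  using assms hyperoct_inj[OF assms(1)] hyperoct_zero[OF assms(1)] by (metis injD)

lemma abs_perm_permutes:
  assumes "\<sigma> \<in> carrier (hyperoct r)"
  shows "abs_perm r \<sigma> permutes {1..int r}"
proof -
  from hyperoct_decomposition[OF assms] obtain A \<pi> where "A \<subseteq> {1..int r}" "\<pi> permutes {1..int r}"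
    "\<sigma> = sign_changes A \<otimes>\<^bsub>hyperoct r\<^esub> signed_extension \<pi>" by blast
  from this(2) decomposition_unique(2)[OF this] show ?thesis by (simp add: abs_perm_def)
qed

text \<open>The product is \<open>- 1\<close> to the number of positive symbols that are made negative. This form reads the
  sign off from the values of \<open>\<sigma>\<close>, without a decomposition, so that multiplicativity becomes a
  computation.\<close>

lemma hsgn_eq_prod:
  assumes s: "\<sigma> \<in> carrier (hyperoct r)"
  shows "hsgn r \<sigma> = (\<Prod>i\<in>{1..int r}. sgn (\<sigma> i)) * sign (abs_perm r \<sigma>)"
proof -
  from hyperoct_decomposition[OF s] obtain A \<pi> where A: "A \<subseteq> {1..int r}" "\<pi> permutes {1..int r}"
    and e: "\<sigma> = sign_changes A \<otimes>\<^bsub>hyperoct r\<^esub> signed_extension \<pi>" by blast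
  note u = decomposition_unique[OF A e]
  have "(\<Prod>i\<in>{1..int r}. sgn (\<sigma> i)) = (\<Prod>i\<in>{1..int r}. if i \<in> A then - 1 else 1)"
  proof (rule prod.cong[OF refl])
    fix i assume i: "i \<in> {1..int r}"
    then have "\<sigma> i \<noteq> 0" using hyperoct_neq_0[OF s, of i] by auto
    then show "sgn (\<sigma> i) = (if i \<in> A then - 1 else 1)" using i u(1) by (auto simp: sgn_if)
  qed
  also have "\<dots> = (- 1) ^ card A"
    using A(1) by (simp add: prod.If_cases Int_absorb1)
  finally show ?thesis using hsgn_eq[OF A] u(2) e by (simp add: abs_perm_def)
qed

text \<open>The sign of \<open>\<tau> (\<sigma> i)\<close> is that of \<open>\<sigma> i\<close> times that of \<open>\<tau> \<bar>\<sigma> i\<bar>\<close>, and \<open>i \<mapsto> \<bar>\<sigma> i\<bar>\<close> permutes the factors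
  of the second kind.\<close>

lemma hsgn_comp:
  assumes s: "\<sigma> \<in> carrier (hyperoct r)" and t: "\<tau> \<in> carrier (hyperoct r)"
  shows "hsgn r (\<tau> \<circ> \<sigma>) = hsgn r \<tau> * hsgn r \<sigma>"
proof -
  let ?I = "{1..int r}"
  note ps = abs_perm_permutes[OF s] and pt = abs_perm_permutes[OF t]
  have abs: "\<bar>\<tau> \<bar>x\<bar>\<bar> = \<bar>\<tau> x\<bar>" for x
    using hyperoct_uminus[OF t, of x] by (cases "x \<ge> 0") auto
  have in_I: "\<bar>\<sigma> i\<bar> \<in> ?I" if "i \<in> ?I" for i
    using permutes_in_image[OF ps, of i] that by (simp add: abs_perm_def)
  have perm: "abs_perm r (\<tau> \<circ> \<sigma>) = abs_perm r \<tau> \<circ> abs_perm r \<sigma>"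
    using in_I by (auto simp: abs_perm_def fun_eq_iff abs)
  have fin: "permutation (abs_perm r \<sigma>)" "permutation (abs_perm r \<tau>)"
    using ps pt by (auto intro: permutes_imp_permutation[OF finite_atLeastAtMost_int])
  have "(\<Prod>i\<in>?I. sgn ((\<tau> \<circ> \<sigma>) i)) = (\<Prod>i\<in>?I. sgn (\<sigma> i) * sgn (\<tau> (abs_perm r \<sigma> i)))"
  proof (rule prod.cong[OF refl])
    fix i assume i: "i \<in> ?I"
    then have "\<sigma> i \<noteq> 0" using hyperoct_neq_0[OF s, of i] by auto
    then show "sgn ((\<tau> \<circ> \<sigma>) i) = sgn (\<sigma> i) * sgn (\<tau> (abs_perm r \<sigma> i))"
      using i hyperoct_uminus[OF t, of "\<sigma> i"] by (auto simp: abs_perm_def abs_if sgn_minus)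
  qed
  also have "\<dots> = (\<Prod>i\<in>?I. sgn (\<sigma> i)) * (\<Prod>i\<in>?I. sgn (\<tau> i))"
    using prod.permute[OF ps, of "\<lambda>i. sgn (\<tau> i)"] by (simp add: prod.distrib comp_def)
  finally show ?thesis
    by (simp add: hsgn_eq_prod s t hyperoct_comp perm sign_compose fin)
qed

section \<open>Sign changes and signed transpositions\<close>

abbreviation sign_change :: "int \<Rightarrow> int \<Rightarrow> int"
  where "sign_change a \<equiv> sign_changes {\<bar>a\<bar>}"

lemma involution_permutes:
  assumes "\<And>z. p (p z) = z" "\<And>z. z \<notin> S \<Longrightarrow> p z = z"
  shows "p permutes S"
  unfolding permutes_def using assms by metis

lemma sign_change_hyperoct:
  "a \<in> signed_symbols r \<Longrightarrow> sign_change a \<in> carrier (hyperoct r)"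
  by (auto simp: hyperoct_def sign_changes_def signed_symbols_def intro!: involution_permutes
      split: if_splits)

lemma hsgn_sign_change:
  assumes "a \<in> signed_symbols r"
  shows "hsgn r (sign_change a) = - 1"
proof -
  have "signed_extension id = id" by (auto simp: signed_extension_def)
  then have "sign_change a \<otimes>\<^bsub>hyperoct r\<^esub> signed_extension id = sign_change a"
    by (simp add: hyperoct_def)
  moreover have "{\<bar>a\<bar>} \<subseteq> {1..int r}" using assms by (auto simp: signed_symbols_def)
  ultimately show ?thesis using hsgn_eq[of "{\<bar>a\<bar>}" r id] by (simp add: permutes_id)
qed

text \<open>Conjugation permutes the sign changes as the group permutes absolute values.\<close>

lemma sign_change_comp:
  assumes "\<rho> \<in> carrier (hyperoct r)"
  shows "sign_change (\<rho> a) \<circ> \<rho> = \<rho> \<circ> sign_change a"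
proof
  fix x
  have "\<bar>\<rho> x\<bar> = \<bar>\<rho> a\<bar> \<longleftrightarrow> \<bar>x\<bar> = \<bar>a\<bar>"
    using hyperoct_inj[OF assms] hyperoct_uminus[OF assms]
    by (metis abs_eq_iff injD)
  then show "(sign_change (\<rho> a) \<circ> \<rho>) x = (\<rho> \<circ> sign_change a) x"
    by (simp add: sign_changes_def hyperoct_uminus[OF assms])
qed

lemma sign_change_blocks_stabilizer:
  assumes "a \<in> signed_symbols r" "\<And>A. A \<in> F \<Longrightarrow> a \<in> A \<longleftrightarrow> - a \<in> A"
  shows "sign_change a \<in> blocks_stabilizer r F"
proof -
  have "sign_change a ` A = A" if "A \<in> F" for A
  proof -
    have "sign_change a x \<in> A" if "x \<in> A" for x
      using assms(2)[OF \<open>A \<in> F\<close>] that by (auto simp: sign_changes_def abs_eq_iff)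
    moreover have "sign_change a (sign_change a x) = x" for x
      by (simp add: sign_changes_def)
    ultimately show ?thesis by (metis image_iff subsetI subset_antisym)
  qed
  then show ?thesis using sign_change_hyperoct[OF assms(1)] by (simp add: blocks_stabilizer_def)
qed

text \<open>The element interchanging \<open>x\<close> with \<open>y\<close> and \<open>- x\<close> with \<open>- y\<close>. Allowing \<open>x\<close> and \<open>y\<close> to be negative
  matters: if the entries \<open>\<plusminus>a\<close>, \<open>\<plusminus>b\<close> lie in one row of one tableau and one column of another, only one
  of the two elements interchanging \<open>\<bar>a\<bar>\<close> and \<open>\<bar>b\<bar>\<close> in absolute value belongs to the group that
  may not change signs.\<close>

definition signed_swap :: "int \<Rightarrow> int \<Rightarrow> int \<Rightarrow> int"
  where "signed_swap x y = (\<lambda>z. if z = x then y else if z = y then x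
    else if z = - x then - y else if z = - y then - x else z)"

lemma signed_swap_simps:
  assumes "\<bar>x\<bar> \<noteq> \<bar>y\<bar>" "x \<noteq> 0" "y \<noteq> 0"
  shows "signed_swap x y x = y" "signed_swap x y y = x"
    "signed_swap x y (- x) = - y" "signed_swap x y (- y) = - x"
proof -
  have "x \<noteq> y" "y \<noteq> x" "x \<noteq> - y" "- x \<noteq> y" "- y \<noteq> x" "- x \<noteq> x" "- y \<noteq> y" using assms by auto
  then show "signed_swap x y x = y" "signed_swap x y y = x"
    "signed_swap x y (- x) = - y" "signed_swap x y (- y) = - x" by (simp_all add: signed_swap_def)
qed

lemma signed_swap_other: "\<bar>z\<bar> \<noteq> \<bar>x\<bar> \<Longrightarrow> \<bar>z\<bar> \<noteq> \<bar>y\<bar> \<Longrightarrow> signed_swap x y z = z"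
  unfolding signed_swap_def by (metis abs_minus_cancel)

lemma signed_symbol_cases:
  obtains "z = x" | "z = - x" | "z = y" | "z = - y" | "\<bar>z\<bar> \<noteq> \<bar>x\<bar>" "\<bar>z\<bar> \<noteq> \<bar>y :: int\<bar>"
  unfolding abs_eq_iff by blast

lemma signed_swap_involutive:
  assumes "\<bar>x\<bar> \<noteq> \<bar>y\<bar>" "x \<noteq> 0" "y \<noteq> 0"
  shows "signed_swap x y (signed_swap x y z) = z"
  by (rule signed_symbol_cases[where z = z and x = x and y = y]) (simp_all add: signed_swap_simps[OF assms] signed_swap_other)

lemma signed_swap_uminus:
  assumes "\<bar>x\<bar> \<noteq> \<bar>y\<bar>" "x \<noteq> 0" "y \<noteq> 0"
  shows "signed_swap x y (- z) = - signed_swap x y z"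
  by (rule signed_symbol_cases[where z = z and x = x and y = y]) (simp_all add: signed_swap_simps[OF assms] signed_swap_other)

lemma abs_signed_swap:
  assumes "\<bar>x\<bar> \<noteq> \<bar>y\<bar>" "x \<noteq> 0" "y \<noteq> 0"
  shows "\<bar>signed_swap x y z\<bar> = transpose \<bar>x\<bar> \<bar>y\<bar> \<bar>z\<bar>"
  by (rule signed_symbol_cases[where z = z and x = x and y = y]) (simp_all add: signed_swap_simps[OF assms] signed_swap_other)

text \<open>Only \<open>\<bar>x\<bar>\<close> and \<open>\<bar>y\<bar>\<close> can contribute a sign to the product in \<open>hsgn_eq_prod\<close>, and they contribute
  the same one. So a signed transposition is always odd, whether it involves no or two sign changes.\<close>

lemma sgn_signed_swap:
  assumes "\<bar>x\<bar> \<noteq> \<bar>y\<bar>" "x \<noteq> 0" "y \<noteq> 0"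
  shows "sgn (signed_swap x y \<bar>x\<bar>) = sgn x * sgn y" "sgn (signed_swap x y \<bar>y\<bar>) = sgn x * sgn y"
  using assms(2,3) by (simp_all add: abs_if signed_swap_simps[OF assms])

lemma signed_swap_hyperoct:
  assumes "x \<in> signed_symbols r" "y \<in> signed_symbols r" "\<bar>x\<bar> \<noteq> \<bar>y\<bar>"
  shows "signed_swap x y \<in> carrier (hyperoct r)"
proof -
  have nz: "x \<noteq> 0" "y \<noteq> 0" using assms by (auto simp: signed_symbols_def)
  note inv = signed_swap_involutive[OF assms(3) nz]
  have "signed_swap x y z = z" if "z \<notin> signed_symbols r" for z
    using assms(1,2) that by (auto simp: signed_symbols_def signed_swap_def)
  then have "signed_swap x y permutes signed_symbols r"
    by (intro involution_permutes inv)
  then show ?thesis by (simp add: hyperoct_def signed_swap_uminus[OF assms(3) nz])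
qed

lemma hsgn_signed_swap:
  assumes x: "x \<in> signed_symbols r" and y: "y \<in> signed_symbols r" and xy: "\<bar>x\<bar> \<noteq> \<bar>y\<bar>"
  shows "hsgn r (signed_swap x y) = - 1"
proof -
  have nz: "x \<noteq> 0" "y \<noteq> 0" using x y by (auto simp: signed_symbols_def)
  have I: "\<bar>x\<bar> \<in> {1..int r}" "\<bar>y\<bar> \<in> {1..int r}" using x y by (auto simp: signed_symbols_def)
  have "abs_perm r (signed_swap x y) = transpose \<bar>x\<bar> \<bar>y\<bar>"
    using I by (auto simp: abs_perm_def fun_eq_iff abs_signed_swap[OF xy nz] transpose_def)
  then have "sign (abs_perm r (signed_swap x y)) = - 1"
    using xy by (simp add: sign_swap_id)
  moreover have "(\<Prod>i\<in>{1..int r}. sgn (signed_swap x y i)) = 1"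
  proof -
    have "(\<Prod>i\<in>{1..int r}. sgn (signed_swap x y i)) = (\<Prod>i\<in>{\<bar>x\<bar>, \<bar>y\<bar>}. sgn (signed_swap x y i))"
    proof (intro prod.mono_neutral_right ballI)
      fix i assume i: "i \<in> {1..int r} - {\<bar>x\<bar>, \<bar>y\<bar>}"
      then show "sgn (signed_swap x y i) = 1" by (simp add: signed_swap_other)
    qed (use I in auto)
    also have "\<dots> = (sgn x * sgn y) * (sgn x * sgn y)"
      using xy by (simp add: sgn_signed_swap[OF xy nz])
    also have "\<dots> = 1" using nz by (simp add: sgn_if)
    finally show ?thesis .
  qed
  ultimately show ?thesis by (simp add: hsgn_eq_prod signed_swap_hyperoct[OF assms])
qed

lemma signed_swap_blocks_stabilizer:
  assumes "x \<in> signed_symbols r" "y \<in> signed_symbols r" "\<bar>x\<bar> \<noteq> \<bar>y\<bar>"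
    and "\<And>A. A \<in> F \<Longrightarrow> x \<in> A \<longleftrightarrow> y \<in> A" "\<And>A. A \<in> F \<Longrightarrow> - x \<in> A \<longleftrightarrow> - y \<in> A"
  shows "signed_swap x y \<in> blocks_stabilizer r F"
proof -
  have "x \<noteq> 0" "y \<noteq> 0" using assms(1,2) by (auto simp: signed_symbols_def)
  note inv = signed_swap_involutive[OF assms(3) this]
  have "signed_swap x y ` A = A" if "A \<in> F" for A
  proof -
    have "signed_swap x y z \<in> A" if "z \<in> A" for z
      using assms(4,5)[OF \<open>A \<in> F\<close>] that unfolding signed_swap_def by metis
    then show ?thesis using inv by (metis image_iff subsetI subset_antisym)
  qed
  then show ?thesis
    using signed_swap_hyperoct[OF assms(1-3)] by (simp add: blocks_stabilizer_def)
qed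

section \<open>Elements of row and column groups\<close>

lemma bitableau_entry_inj:
  assumes "t \<in> bitableaux r l" "b \<in> boxes l" "c \<in> boxes l" "\<bar>t b\<bar> = \<bar>t c\<bar>"
  shows "b = c"
  using assms unfolding bitableaux_def bij_betw_def by (blast dest: inj_onD)

lemma bitableau_entry_symbol:
  assumes "t \<in> bitableaux r l" "b \<in> boxes l"
  shows "t b \<in> signed_symbols r"
proof -
  have "\<bar>t b\<bar> \<in> {1..int r}" using assms unfolding bitableaux_def by (blast dest: bij_betwE)
  then show ?thesis by (auto simp: signed_symbols_def)
qed

lemma Inl_boxes [simp]: "Inl d \<in> boxes l \<longleftrightarrow> d \<in> diagram (fst l)"
  and Inr_boxes [simp]: "Inr d \<in> boxes l \<longleftrightarrow> d \<in> diagram (snd l)"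
  by (auto simp: boxes_def)

lemma in_pm: "x \<in> pm A \<longleftrightarrow> x \<in> A \<or> - x \<in> A"
  by (force simp: pm_def)

lemma uminus_in_pm [simp]: "- x \<in> pm A \<longleftrightarrow> x \<in> pm A"
  by (auto simp: in_pm)


lemma bitableau_entry_mem:
  assumes t: "t \<in> bitableaux r l" and b: "b \<in> boxes l" and B: "B \<subseteq> boxes l"
  shows "t b \<in> t ` B \<longleftrightarrow> b \<in> B" "- t b \<notin> t ` B"
    "\<bar>x\<bar> = \<bar>t b\<bar> \<Longrightarrow> x \<in> pm (t ` B) \<longleftrightarrow> b \<in> B"
proof -
  have inj: "b = c" if "c \<in> B" "\<bar>t b\<bar> = \<bar>t c\<bar>" for c
    using bitableau_entry_inj[OF t b] B that by blast
  show 1: "t b \<in> t ` B \<longleftrightarrow> b \<in> B" using inj by auto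
  have "t b \<noteq> 0" using bitableau_entry_symbol[OF t b] by (simp add: signed_symbols_def)
  then have "- t b \<noteq> t b" by simp
  then show 2: "- t b \<notin> t ` B" using inj by fastforce
  assume "\<bar>x\<bar> = \<bar>t b\<bar>"
  then have "x = t b \<or> x = - t b" by (simp add: abs_eq_iff)
  then show "x \<in> pm (t ` B) \<longleftrightarrow> b \<in> B" using 1 2 by (auto simp: in_pm)
qed

lemma lines_boxes: "B \<in> lines_fst c l \<union> lines_snd c l \<Longrightarrow> B \<subseteq> boxes l"
  by (auto simp: lines_fst_def lines_snd_def)

lemma symbol_of_abs: "\<bar>x\<bar> = \<bar>y\<bar> \<Longrightarrow> y \<in> signed_symbols r \<Longrightarrow> x \<in> signed_symbols r"
  by (auto simp: signed_symbols_def)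

text \<open>In a line of \<open>N\<close> only the elements of the group that match the actual signs of the entries are
  allowed; in a line of \<open>P\<close>, which is stable under sign changes, the signs of \<open>x\<close> and \<open>y\<close> are arbitrary.\<close>

lemma signed_swap_entry_blocks:
  assumes t: "t \<in> bitableaux r l" and b: "b \<in> boxes l" "c \<in> boxes l" "b \<noteq> c"
    and x: "\<bar>x\<bar> = \<bar>t b\<bar>" "\<bar>y\<bar> = \<bar>t c\<bar>"
    and PN: "\<And>B. B \<in> P \<union> N \<Longrightarrow> B \<subseteq> boxes l" "\<And>B. B \<in> P \<union> N \<Longrightarrow> b \<in> B \<longleftrightarrow> c \<in> B"
    and N: "\<And>B. B \<in> N \<Longrightarrow> b \<in> B \<Longrightarrow> x = t b \<and> y = t c"
  shows "signed_swap x y \<in> blocks_stabilizer r (entry_blocks t P N)"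
proof (rule signed_swap_blocks_stabilizer)
  show "x \<in> signed_symbols r" "y \<in> signed_symbols r"
    using bitableau_entry_symbol[OF t] b x by (blast intro: symbol_of_abs)+
  show "\<bar>x\<bar> \<noteq> \<bar>y\<bar>" using bitableau_entry_inj[OF t b(1,2)] b(3) x by auto
  fix A assume "A \<in> entry_blocks t P N"
  then obtain B where B: "B \<in> P \<union> N" and A: "A = pm (t ` B) \<or> B \<in> N \<and> A = t ` B"
    by (auto simp: entry_blocks_def)
  note mb = bitableau_entry_mem[OF t b(1) PN(1)[OF B]] and mc = bitableau_entry_mem[OF t b(2) PN(1)[OF B]]
  note bc = PN(2)[OF B]
  from A N consider "A = pm (t ` B)" | "A = t ` B" "x = t b" "y = t c" | "A = t ` B" "b \<notin> B" by blast
  then have "(x \<in> A \<longleftrightarrow> y \<in> A) \<and> (- x \<in> A \<longleftrightarrow> - y \<in> A)"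
  proof cases
    case 3
    then show ?thesis using mb mc x bc by (auto simp: abs_eq_iff)
  qed (use mb mc x bc in auto)
  then show "x \<in> A \<longleftrightarrow> y \<in> A" "- x \<in> A \<longleftrightarrow> - y \<in> A" by blast+
qed

lemma sign_change_entry_blocks:
  assumes t: "t \<in> bitableaux r l" and b: "b \<in> boxes l" and a: "\<bar>a\<bar> = \<bar>t b\<bar>"
    and PN: "\<And>B. B \<in> P \<union> N \<Longrightarrow> B \<subseteq> boxes l" and N: "\<And>B. B \<in> N \<Longrightarrow> b \<notin> B"
  shows "sign_change a \<in> blocks_stabilizer r (entry_blocks t P N)"
proof (rule sign_change_blocks_stabilizer)
  show "a \<in> signed_symbols r" using symbol_of_abs[OF a bitableau_entry_symbol[OF t b]] .
  fix A assume "A \<in> entry_blocks t P N"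
  then obtain B where B: "B \<in> P \<union> N" and A: "A = pm (t ` B) \<or> B \<in> N \<and> A = t ` B"
    by (auto simp: entry_blocks_def)
  from A show "a \<in> A \<longleftrightarrow> - a \<in> A"
  proof
    assume "B \<in> N \<and> A = t ` B"
    then show ?thesis using bitableau_entry_mem[OF t b PN[OF B]] N a by (auto simp: abs_eq_iff)
  qed simp
qed

lemma col_group_signed_swap_fst:
  assumes t: "t \<in> bitableaux r l" and d: "d \<in> diagram (fst l)" "e \<in> diagram (fst l)"
    and de: "d \<noteq> e" "snd d = snd e" and x: "\<bar>x\<bar> = \<bar>t (Inl d)\<bar>" "\<bar>y\<bar> = \<bar>t (Inl e)\<bar>"
  shows "signed_swap x y \<in> col_group r l t"
  unfolding col_group_eq
  by (rule signed_swap_entry_blocks[OF t _ _ _ x lines_boxes])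
    (use d de in \<open>auto simp: lines_fst_def lines_snd_def\<close>)

lemma col_group_signed_swap_snd:
  assumes t: "t \<in> bitableaux r l" and d: "d \<in> diagram (snd l)" "e \<in> diagram (snd l)"
    and de: "d \<noteq> e" "snd d = snd e"
  shows "signed_swap (t (Inr d)) (t (Inr e)) \<in> col_group r l t"
  unfolding col_group_eq
  by (rule signed_swap_entry_blocks[OF t _ _ _ refl refl lines_boxes])
    (use d de in \<open>auto simp: lines_fst_def lines_snd_def\<close>)

lemma row_group_signed_swap_fst:
  assumes t: "t \<in> bitableaux r l" and d: "d \<in> diagram (fst l)" "e \<in> diagram (fst l)"
    and de: "d \<noteq> e" "fst d = fst e"
  shows "signed_swap (t (Inl d)) (t (Inl e)) \<in> row_group r l t"
  unfolding row_group_eq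
  by (rule signed_swap_entry_blocks[OF t _ _ _ refl refl lines_boxes[of _ fst]])
    (use d de in \<open>auto simp: lines_fst_def lines_snd_def\<close>)

lemma row_group_signed_swap_snd:
  assumes t: "t \<in> bitableaux r l" and d: "d \<in> diagram (snd l)" "e \<in> diagram (snd l)"
    and de: "d \<noteq> e" "fst d = fst e" and x: "\<bar>x\<bar> = \<bar>t (Inr d)\<bar>" "\<bar>y\<bar> = \<bar>t (Inr e)\<bar>"
  shows "signed_swap x y \<in> row_group r l t"
  unfolding row_group_eq
  by (rule signed_swap_entry_blocks[OF t _ _ _ x lines_boxes[of _ fst]])
    (use d de in \<open>auto simp: lines_fst_def lines_snd_def\<close>)

definition entries_fst :: "bipartition \<Rightarrow> bitableau \<Rightarrow> int set"
  where "entries_fst l t = (\<lambda>d. \<bar>t (Inl d)\<bar>) ` diagram (fst l)"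

definition entries_snd :: "bipartition \<Rightarrow> bitableau \<Rightarrow> int set"
  where "entries_snd l t = (\<lambda>d. \<bar>t (Inr d)\<bar>) ` diagram (snd l)"

text \<open>Up to sign, the two components of a bi-tableau share out the symbols; an inclusion between first
  components is thereby an opposite inclusion between second components.\<close>

lemma entries_cover:
  assumes "t \<in> bitableaux r l"
  shows "entries_fst l t \<union> entries_snd l t = {1..int r}"
proof -
  have "(\<lambda>b. \<bar>t b\<bar>) ` boxes l = {1..int r}"
    using assms by (simp add: bitableaux_def bij_betw_def)
  moreover have "boxes l = Inl ` diagram (fst l) \<union> Inr ` diagram (snd l)"
    by (auto simp: boxes_def)
  ultimately show ?thesis
    by (simp add: image_Un image_image entries_fst_def entries_snd_def)
qed

lemma entries_disjoint:
  assumes "t \<in> bitableaux r l"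
  shows "entries_fst l t \<inter> entries_snd l t = {}"
  using bitableau_entry_inj[OF assms]
  by (force simp: entries_fst_def entries_snd_def)

lemma card_entries_fst:
  assumes "t \<in> bitableaux r l"
  shows "card (entries_fst l t) = card (diagram (fst l))"
  unfolding entries_fst_def
  by (rule card_image) (use bitableau_entry_inj[OF assms] in \<open>force intro!: inj_onI\<close>)

lemma col_group_sign_change:
  assumes t: "t \<in> bitableaux r l" and a: "\<bar>a\<bar> \<in> entries_fst l t"
  shows "sign_change a \<in> col_group r l t"
proof -
  from a obtain d where "d \<in> diagram (fst l)" "\<bar>a\<bar> = \<bar>t (Inl d)\<bar>" by (auto simp: entries_fst_def)
  then show ?thesis unfolding col_group_eq
    by (intro sign_change_entry_blocks[OF t, of "Inl d"] lines_boxes[of _ snd])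
      (auto simp: lines_snd_def)
qed

lemma row_group_sign_change:
  assumes t: "t \<in> bitableaux r l" and a: "\<bar>a\<bar> \<in> entries_snd l t"
  shows "sign_change a \<in> row_group r l t"
proof -
  from a obtain d where "d \<in> diagram (snd l)" "\<bar>a\<bar> = \<bar>t (Inr d)\<bar>" by (auto simp: entries_snd_def)
  then show ?thesis unfolding row_group_eq
    by (intro sign_change_entry_blocks[OF t, of "Inr d"] lines_boxes[of _ fst])
      (auto simp: lines_fst_def)
qed

text \<open>Column permutations move entries only within a component. This is what makes the sign change at
  an entry of \<open>t\<^sup>2\<close> commute past the column group as a sign change at another entry of \<open>t\<^sup>2\<close>.\<close>

lemma col_group_entries_snd:
  assumes t: "\<rho> \<in> col_group r l t" and a: "\<bar>\<rho> a\<bar> \<in> entries_snd l t"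
  shows "\<bar>a\<bar> \<in> entries_snd l t"
proof -
  from a obtain d where d: "d \<in> diagram (snd l)" "\<bar>\<rho> a\<bar> = \<bar>t (Inr d)\<bar>" by (auto simp: entries_snd_def)
  have s: "\<rho> \<in> carrier (hyperoct r)" using t by (simp add: col_group_def)
  let ?C = "t ` Inr ` {e \<in> diagram (snd l). snd e = snd d}"
  have "\<rho> ` ?C = ?C" using t unfolding col_group_eq blocks_stabilizer_def entry_blocks_def lines_snd_def by auto
  then have "t (Inr d) \<in> \<rho> ` ?C" using d(1) by auto
  then obtain e where e: "e \<in> diagram (snd l)" "t (Inr d) = \<rho> (t (Inr e))" by auto
  then have "\<rho> a = \<rho> (t (Inr e)) \<or> \<rho> a = \<rho> (- t (Inr e))"
    using d(2) hyperoct_uminus[OF s] by (simp add: abs_eq_iff)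
  then have "a = t (Inr e) \<or> a = - t (Inr e)" using hyperoct_inj[OF s] by (auto dest: injD)
  then show ?thesis using e(1) by (auto simp: entries_snd_def)
qed

section \<open>Polytabloids under the group action\<close>

lemma tabloid_eq:
  assumes "t \<in> bitableaux r l"
  shows "tabloid r l t = tableau_act t ` row_group r l t"
  using assms tableau_act_closed[OF assms]
  by (auto simp: tabloid_def row_equiv_def row_group_def)

lemma tableau_act_comp: "tableau_act (tableau_act t \<sigma>) \<rho> = tableau_act t (\<rho> \<circ> \<sigma>)"
  by (simp add: tableau_act_def comp_assoc)

text \<open>Every element of the stabilizer maps each block to itself, so the moved tableau has the same
  blocks and hence the same row or column group.\<close>

lemma entry_blocks_act:
  assumes "\<sigma> \<in> blocks_stabilizer r (entry_blocks t P N)"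
  shows "entry_blocks (tableau_act t \<sigma>) P N = entry_blocks t P N"
proof -
  have s: "\<sigma> \<in> carrier (hyperoct r)" using assms by (simp add: blocks_stabilizer_def)
  have "tableau_act t \<sigma> ` B = \<sigma> ` t ` B" for B by (simp add: tableau_act_def image_comp)
  moreover have "\<sigma> ` A = A" if "A \<in> entry_blocks t P N" for A
    using assms that by (simp add: blocks_stabilizer_def)
  ultimately show ?thesis
    unfolding entry_blocks_def by (simp add: pm_image[OF s])
qed

lemma tabloid_row_group:
  assumes t: "t \<in> bitableaux r l" and s: "\<sigma> \<in> row_group r l t"
  shows "tabloid r l (tableau_act t \<sigma>) = tabloid r l t"
proof -
  have h: "\<sigma> \<in> carrier (hyperoct r)" using s by (simp add: row_group_def)
  have g: "row_group r l (tableau_act t \<sigma>) = row_group r l t"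
    using s unfolding row_group_eq by (simp add: entry_blocks_act)
  have "tabloid r l (tableau_act t \<sigma>) = tableau_act t ` (\<lambda>\<rho>. \<rho> \<circ> \<sigma>) ` row_group r l t"
    unfolding tabloid_eq[OF tableau_act_closed[OF t h]] g
    by (simp add: image_image tableau_act_comp)
  also have "(\<lambda>\<rho>. \<rho> \<circ> \<sigma>) ` row_group r l t = row_group r l t"
    using s unfolding row_group_eq by (rule image_blocks_stabilizer_right)
  finally show ?thesis using tabloid_eq[OF t] by simp
qed

abbreviation group_elem :: "(int \<Rightarrow> int) \<Rightarrow> ((int \<Rightarrow> int) \<Rightarrow>\<^sub>0 'k::field)"
  where "group_elem \<sigma> \<equiv> Poly_Mapping.single \<sigma> 1"

lemma fscale_single: "fscale c (Poly_Mapping.single b d) = Poly_Mapping.single b (c * d)"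
  by (rule poly_mapping_eqI) (simp add: lookup_single when_def)

lemma act_add_left: "act (x + y) a = act x a + act y a"
  by (simp add: act_def bilin_add_left)

lemma act_zero_left [simp]: "act 0 a = 0"
  by (simp add: act_def)

lemma act_fscale: "act (fscale c x) (group_elem \<sigma>) = fscale c (act x (group_elem \<sigma>))"
proof (induction x rule: poly_mapping_add_induct)
  case (single a d)
  show ?case by (simp add: act_def fscale_single)
qed (simp_all add: act_add_left free.scale_right_distrib)

lemma act_sum_left: "act (\<Sum>i\<in>I. x i) a = (\<Sum>i\<in>I. act (x i) a)"
  by (induction I rule: infinite_finite_induct) (simp_all add: act_add_left)

lemma act_sum_right: "act x (\<Sum>i\<in>I. a i) = (\<Sum>i\<in>I. act x (a i))"
  by (induction I rule: infinite_finite_induct) (simp_all add: act_def bilin_add_right)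

lemma act_single: "act (Poly_Mapping.single T c) (Poly_Mapping.single \<sigma> d) =
    Poly_Mapping.single (tabloid_act T \<sigma>) (c * d)"
  by (simp add: act_def)

lemma lookup_act:
  assumes "\<sigma> \<in> carrier (hyperoct r)"
  shows "Poly_Mapping.lookup (act x (group_elem \<sigma>)) (tabloid_act T \<sigma>) = Poly_Mapping.lookup x T"
proof -
  have "inj (\<lambda>t. tableau_act t \<sigma>)"
    using hyperoct_inj[OF assms] by (auto simp: inj_def tableau_act_def fun_eq_iff)
  then have inj: "tabloid_act S \<sigma> = tabloid_act T \<sigma> \<longleftrightarrow> S = T" for S
    unfolding tabloid_act_def by (rule inj_image_eq_iff)
  show ?thesis
    by (induction x rule: poly_mapping_add_induct)
      (simp_all add: act_add_left act_single lookup_add lookup_single inj)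
qed

text \<open>The coefficient of a fixed bi-tabloid is carried to itself and negated.\<close>

lemma lookup_antisym_fixed:
  fixes x :: "bitabloid \<Rightarrow>\<^sub>0 'k::field"
  assumes two: "(2 :: 'k) \<noteq> 0" and s: "\<sigma> \<in> carrier (hyperoct r)"
    and x: "act x (group_elem \<sigma>) = - x" and T: "tabloid_act T \<sigma> = T"
  shows "Poly_Mapping.lookup x T = 0"
proof -
  have "Poly_Mapping.lookup x T = - Poly_Mapping.lookup x T"
    using lookup_act[OF s, of x T] unfolding x T by simp
  then have "2 * Poly_Mapping.lookup x T = 0" unfolding eq_neg_iff_add_eq_0 mult_2 .
  then show ?thesis using two by simp
qed

lemma polytabloid_eq: "(polytabloid r l t :: bitabloid \<Rightarrow>\<^sub>0 'k::field) =
    (\<Sum>\<rho>\<in>col_group r l t. Poly_Mapping.single (tabloid r l (tableau_act t \<rho>)) (of_int (hsgn r \<rho>)))"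
  unfolding polytabloid_def col_antisym_def act_sum_right act_single
  by (rule sum.cong) (auto simp: tabloid_act_tabloid col_group_def)

lemma polytabloid_act: 
  assumes s: "\<sigma> \<in> carrier (hyperoct r)"
  shows "act (polytabloid r l t) (group_elem \<sigma>) = (\<Sum>\<rho>\<in>col_group r l t.
    Poly_Mapping.single (tabloid r l (tableau_act t (\<sigma> \<circ> \<rho>))) (of_int (hsgn r \<rho>) :: 'k::field))"
  unfolding polytabloid_eq act_sum_left
  by (simp add: act_single tabloid_act_tabloid[OF s] tableau_act_comp)

text \<open>Translation by \<open>\<sigma>\<close> permutes the terms of the column antisymmetrizer and reverses all their signs.\<close>

lemma polytabloid_odd:
  assumes s: "\<sigma> \<in> col_group r l t" and odd: "hsgn r \<sigma> = - 1"
  shows "act (polytabloid r l t) (group_elem \<sigma>) = - (polytabloid r l t :: bitabloid \<Rightarrow>\<^sub>0 'k::field)"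
proof -
  have h: "\<sigma> \<in> carrier (hyperoct r)" using s by (simp add: col_group_def)
  let ?g = "\<lambda>\<rho>. Poly_Mapping.single (tabloid r l (tableau_act t \<rho>)) (of_int (hsgn r \<rho>) :: 'k)"
  have "act (polytabloid r l t) (group_elem \<sigma>) = (\<Sum>\<rho>\<in>col_group r l t. - ?g (\<sigma> \<circ> \<rho>))"
    unfolding polytabloid_act[OF h]
  proof (rule sum.cong[OF refl])
    fix \<rho> assume "\<rho> \<in> col_group r l t"
    then have "hsgn r (\<sigma> \<circ> \<rho>) = - hsgn r \<rho>"
      using hsgn_comp[OF _ h, of \<rho>] odd by (simp add: col_group_def)
    then show "Poly_Mapping.single (tabloid r l (tableau_act t (\<sigma> \<circ> \<rho>))) (of_int (hsgn r \<rho>)) = - ?g (\<sigma> \<circ> \<rho>)"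
      by (simp flip: single_uminus)
  qed
  also have "\<dots> = - (\<Sum>\<rho>\<in>col_group r l t. ?g \<rho>)"
    using sum.reindex_bij_betw[OF bij_betw_blocks_stabilizer_left[OF s[unfolded col_group_eq]], of ?g]
    unfolding sum_negf col_group_eq by simp
  finally show ?thesis by (simp add: polytabloid_eq)
qed

text \<open>Pushing \<open>\<xi>\<^sub>a\<close> to the front through a term \<open>\<rho>\<close> of the antisymmetrizer turns it into the sign change at
  the symbol that \<open>\<rho>\<close> maps to \<open>a\<close>. That symbol is again in the second component, so the sign change
  lies in the row group and is absorbed by the bi-tabloid.\<close>

lemma polytabloid_sign_change_snd:
  assumes t: "t \<in> bitableaux r l" and a: "\<bar>a\<bar> \<in> entries_snd l t"
  shows "act (polytabloid r l t) (group_elem (sign_change a)) = (polytabloid r l t :: bitabloid \<Rightarrow>\<^sub>0 'k::field)"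
proof -
  have "\<bar>a\<bar> \<in> {1..int r}" using a entries_cover[OF t] by blast
  then have h: "sign_change a \<in> carrier (hyperoct r)"
    by (intro sign_change_hyperoct) (auto simp: signed_symbols_def)
  have "tabloid r l (tableau_act t (sign_change a \<circ> \<rho>)) = tabloid r l (tableau_act t \<rho>)"
    if rho: "\<rho> \<in> col_group r l t" for \<rho>
  proof -
    have r: "\<rho> \<in> carrier (hyperoct r)" using rho by (simp add: col_group_def)
    obtain b where b: "\<rho> b = a"
      using surjD[OF permutes_surj, of \<rho> "signed_symbols r" a] r by (auto simp: hyperoct_def)
    have sb: "sign_change b \<in> row_group r l t"
      using row_group_sign_change[OF t] col_group_entries_snd[OF rho, of b] a b by simp
    have "tabloid r l (tableau_act t (sign_change a \<circ> \<rho>)) =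
        tabloid r l (tableau_act (tableau_act t (sign_change b)) \<rho>)"
      using sign_change_comp[OF r, of b] b by (simp add: tableau_act_comp)
    also have "\<dots> = tabloid_act (tabloid r l t) \<rho>"
      by (simp flip: tabloid_act_tabloid[OF r] add: tabloid_row_group[OF t sb])
    finally show ?thesis by (simp add: tabloid_act_tabloid[OF r])
  qed
  then show ?thesis unfolding polytabloid_act[OF h] unfolding polytabloid_eq by simp
qed

lemma polytabloid_sign_change_fst:
  assumes t: "t \<in> bitableaux r l" and a: "\<bar>a\<bar> \<in> entries_fst l t"
  shows "act (polytabloid r l t) (group_elem (sign_change a)) = - (polytabloid r l t :: bitabloid \<Rightarrow>\<^sub>0 'k::field)"
proof -
  have "\<bar>a\<bar> \<in> {1..int r}" using a entries_cover[OF t] by blast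
  then have "a \<in> signed_symbols r" by (auto simp: signed_symbols_def)
  then show ?thesis using col_group_sign_change[OF t a] by (intro polytabloid_odd hsgn_sign_change)
qed

text \<open>The operator \<open>x \<mapsto> x + x \<xi>\<^sub>a\<close> kills the polytabloids with \<open>a\<close> in the first component and doubles the
  others, while it doubles \<open>v\<close>. Halving writes \<open>v\<close> in terms of the others.\<close>

lemma span_sign_change_invariant:
  fixes v :: "bitabloid \<Rightarrow>\<^sub>0 'k::field"
  assumes two: "(2 :: 'k) \<noteq> 0" and S: "S \<subseteq> bitableaux r l" and a: "a \<in> {1..int r}"
    and v: "v \<in> free_span (polytabloid r l ` S)" and inv: "act v (group_elem (sign_change a)) = v"
  shows "v \<in> free_span (polytabloid r l ` {t \<in> S. a \<notin> entries_fst l t})"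
proof -
  let ?S' = "{t \<in> S. a \<notin> entries_fst l t}"
  have "v + act v (group_elem (sign_change a)) \<in> free_span (polytabloid r l ` ?S')"
    using v
  proof (induction rule: free.span_induct_alt)
    case base
    show ?case by (simp add: free.span_zero)
  next
    case (step c x y)
    then obtain t where t: "t \<in> bitableaux r l" "t \<in> S" "x = polytabloid r l t" using S by blast
    have abs: "\<bar>a\<bar> = a" using a by simp
    have "x + act x (group_elem (sign_change a)) \<in> free_span (polytabloid r l ` ?S')"
    proof (cases "a \<in> entries_fst l t")
      case True
      then have "act x (group_elem (sign_change a)) = - x"
        unfolding t(3) by (intro polytabloid_sign_change_fst[OF t(1)]) (simp add: abs)
      then show ?thesis by (simp add: free.span_zero)
    next
      case False
      then have "a \<in> entries_snd l t" using entries_cover[OF t(1)] a by blast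
      then have "act x (group_elem (sign_change a)) = x"
        unfolding t(3) by (intro polytabloid_sign_change_snd[OF t(1)]) (simp add: abs)
      moreover have "x \<in> free_span (polytabloid r l ` ?S')"
        using t False by (auto intro: free.span_base)
      ultimately show ?thesis by (simp add: free.span_add)
    qed
    then have "fscale c (x + act x (group_elem (sign_change a))) +
        (y + act y (group_elem (sign_change a))) \<in> free_span (polytabloid r l ` ?S')"
      by (rule free.span_add[OF free.span_scale step.IH])
    then show ?case
      by (simp add: act_add_left act_fscale free.scale_right_distrib add_ac)
  qed
  then have "fscale (1 / 2) (v + v) \<in> free_span (polytabloid r l ` ?S')"
    unfolding inv by (rule free.span_scale)
  moreover have "fscale (1 / 2) (v + v) = v"
    using two by (intro poly_mapping_eqI) (simp add: lookup_add flip: mult_2)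
  ultimately show ?thesis by simp
qed

lemma Specht_sign_change_invariant:
  fixes v :: "bitabloid \<Rightarrow>\<^sub>0 'k::field"
  assumes two: "(2 :: 'k) \<noteq> 0" and v: "v \<in> Specht r l" and B: "finite B" "B \<subseteq> {1..int r}"
    and inv: "\<And>a. a \<in> B \<Longrightarrow> act v (group_elem (sign_change a)) = v"
  shows "v \<in> free_span (polytabloid r l ` {t \<in> bitableaux r l. entries_fst l t \<inter> B = {}})"
  using B inv
proof (induction B rule: finite_induct)
  case empty
  then show ?case using v by (simp add: Specht_def)
next
  case (insert a B)
  have "v \<in> free_span (polytabloid r l ` {t \<in> {t \<in> bitableaux r l. entries_fst l t \<inter> B = {}}. a \<notin> entries_fst l t})"
  proof (rule span_sign_change_invariant[OF two _ _ insert.IH])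
    show "act v (group_elem (sign_change a)) = v" using insert.prems(2) by blast
    show "act v (group_elem (sign_change b)) = v" if "b \<in> B" for b using insert.prems(2) that by blast
  qed (use insert.prems(1) in auto)
  also have "{t \<in> {t \<in> bitableaux r l. entries_fst l t \<inter> B = {}}. a \<notin> entries_fst l t} =
      {t \<in> bitableaux r l. entries_fst l t \<inter> insert a B = {}}" by blast
  finally show ?case .
qed

lemma polytabloid_perm_module:
  assumes "t \<in> bitableaux r l"
  shows "polytabloid r l t \<in> perm_module r l"
  unfolding polytabloid_def
proof (rule act_closed)
  show "Poly_Mapping.single (tabloid r l t) 1 \<in> perm_module r l"
    using assms by (simp add: perm_module_def bitabloids_def tabloid_def quotientI)
  show "col_antisym r l t \<in> carrier (group_algebra r)"
    by (auto simp: col_antisym_def group_algebra_def col_group_def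
        dest!: subsetD[OF keys_sum] split: if_splits)
qed

lemma Specht_subset_perm_module: "Specht r l \<subseteq> perm_module r l"
  unfolding Specht_def
proof (rule free.span_minimal)
  show "polytabloid r l ` bitableaux r l \<subseteq> perm_module r l"
    using polytabloid_perm_module by blast
  show "free.subspace (perm_module r l)"
    by (rule free.subspaceI) (auto simp: perm_module_def in_keys_iff lookup_add dest!: subsetD[OF keys_add])
qed

section \<open>Counting boxes\<close>

lemma finite_diagram: "finite (diagram p)"
proof -
  have "diagram p = Sigma {..<length p} (\<lambda>i. {..<p ! i})" by (auto simp: diagram_def)
  then show ?thesis by simp
qed

lemma card_diagram_rows: "card {d \<in> diagram p. fst d < j} = sum_list (take j p)"
proof -
  have "{d \<in> diagram p. fst d < j} = Sigma {..<min (length p) j} (\<lambda>i. {..<p ! i})"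
    by (auto simp: diagram_def)
  then have "card {d \<in> diagram p. fst d < j} = (\<Sum>i<min (length p) j. p ! i)" by simp
  also have "\<dots> = sum_list (take j p)"
    by (simp add: sum_list_sum_nth atLeast0LessThan)
  finally show ?thesis .
qed

lemma card_diagram: "card (diagram p) = sum_list p"
proof -
  have "{d \<in> diagram p. fst d < length p} = diagram p" by (auto simp: diagram_def)
  then show ?thesis using card_diagram_rows[of p "length p"] by simp
qed

lemma diagram_up_closed:
  assumes "is_partition p" "(i, k) \<in> diagram p" "i' \<le> i"
  shows "(i', k) \<in> diagram p"
proof -
  have "i < length p" "k < p ! i" using assms(2) by (auto simp: diagram_def)
  moreover have "p ! i \<le> p ! i'" if "i' < i"
    using assms(1) sorted_wrt_nth_less[of "(\<ge>)" p i' i] that \<open>i < length p\<close>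
    by (simp add: is_partition_def)
  ultimately show ?thesis using assms(3) by (cases "i' = i") (auto simp: diagram_def)
qed

text \<open>The map \<open>\<phi>\<close> sends the box of a symbol in one tableau to its box in the other. At most \<open>j\<close> boxes of
  the first \<open>j\<close> rows of \<open>q\<close> land in a given column \<open>k\<close> of \<open>p\<close>, one from each row, and certainly no more than that
  column has. The smaller of these two bounds is the number of boxes of column \<open>k\<close> in the first
  \<open>j\<close> rows of \<open>p\<close>; summing over \<open>k\<close> gives the claim.\<close>

lemma partial_sums_le_of_row_col_transversal:
  assumes p: "is_partition p"
    and \<phi>: "\<phi> ` diagram q \<subseteq> diagram p" "inj_on \<phi> (diagram q)"
    and transversal: "\<And>d e. \<lbrakk>d \<in> diagram q; e \<in> diagram q; fst d = fst e;
      snd (\<phi> d) = snd (\<phi> e)\<rbrakk> \<Longrightarrow> d = e"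
  shows "sum_list (take j q) \<le> sum_list (take j p)"
proof -
  define X where "X k = {d \<in> diagram q. fst d < j \<and> snd (\<phi> d) = k}" for k
  define Y where "Y k = {d \<in> diagram p. fst d < j \<and> snd d = k}" for k
  have fin: "finite (X k)" "finite (Y k)" for k by (simp_all add: X_def Y_def finite_diagram)
  have XY: "card (X k) \<le> card (Y k)" for k
  proof (cases "\<forall>i<j. (i, k) \<in> diagram p")
    case True
    \<comment> \<open>Column \<open>k\<close> has at least \<open>j\<close> boxes: one box from each row is the sharper bound.\<close>
    have "inj_on fst (X k)" "fst ` X k \<subseteq> {..<j}"
      using transversal by (auto simp: X_def intro!: inj_onI)
    then have "card (X k) \<le> card {..<j}" by (intro card_inj_on_le) auto
    also have "\<dots> = card ((\<lambda>i. (i, k)) ` {..<j})" by (rule card_image[symmetric]) (simp add: inj_on_def)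
    also have "\<dots> \<le> card (Y k)"
      by (rule card_mono[OF fin(2)]) (use True in \<open>auto simp: Y_def\<close>)
    finally show ?thesis .
  next
    case False
    \<comment> \<open>Column \<open>k\<close> has fewer than \<open>j\<close> boxes: its height is the sharper bound.\<close>
    then obtain i0 where "i0 < j" "(i0, k) \<notin> diagram p" by blast
    then have rows: "i < j" if "(i, k) \<in> diagram p" for i
      using diagram_up_closed[OF p that, of i0] by force
    have "\<phi> ` X k \<subseteq> Y k"
    proof
      fix d assume "d \<in> \<phi> ` X k"
      then have "d \<in> diagram p" "snd d = k" using \<phi>(1) by (auto simp: X_def)
      then show "d \<in> Y k" using rows[of "fst d"] by (cases d) (auto simp: Y_def)
    qed
    moreover have "inj_on \<phi> (X k)" by (rule inj_on_subset[OF \<phi>(2)]) (auto simp: X_def)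
    ultimately show ?thesis by (intro card_inj_on_le fin)
  qed
  let ?K = "(\<lambda>d. snd (\<phi> d)) ` diagram q"
  have finK: "finite ?K" by (simp add: finite_diagram)
  have "sum_list (take j q) = card (\<Union>k\<in>?K. X k)"
    unfolding card_diagram_rows[symmetric] by (rule arg_cong[where f = card]) (auto simp: X_def)
  also have "\<dots> \<le> (\<Sum>k\<in>?K. card (X k))" by (rule card_UN_le[OF finK])
  also have "\<dots> \<le> (\<Sum>k\<in>?K. card (Y k))" by (rule sum_mono[OF XY])
  also have "\<dots> = card (\<Union>k\<in>?K. Y k)"
    by (rule card_UN_disjoint[symmetric, OF finK]) (use fin in \<open>auto simp: Y_def\<close>)
  also have "\<dots> \<le> card {d \<in> diagram p. fst d < j}"
    by (rule card_mono) (auto simp: Y_def finite_diagram)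
  finally show ?thesis unfolding card_diagram_rows .
qed

lemma partial_sums_le_of_fillings:
  fixes u v :: "nat \<times> nat \<Rightarrow> int"
  assumes p: "is_partition p" and sub: "v ` diagram q \<subseteq> u ` diagram p"
    and inj: "inj_on v (diagram q)"
    and transversal: "\<And>d e d' e'. \<lbrakk>d \<in> diagram p; e \<in> diagram p; d \<noteq> e; snd d = snd e;
      d' \<in> diagram q; e' \<in> diagram q; fst d' = fst e'; v d' = u d; v e' = u e\<rbrakk> \<Longrightarrow> False"
  shows "sum_list (take j q) \<le> sum_list (take j p)"
proof -
  define \<phi> where "\<phi> d = inv_into (diagram p) u (v d)" for d
  have \<phi>: "\<phi> d \<in> diagram p" "u (\<phi> d) = v d" if "d \<in> diagram q" for d
    using subsetD[OF sub imageI[OF that]] unfolding \<phi>_def by (rule inv_into_into f_inv_into_f)+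
  have eq: "d = e" if "d \<in> diagram q" "e \<in> diagram q" "\<phi> d = \<phi> e" for d e
    using \<phi>(2)[OF that(1)] \<phi>(2)[OF that(2)] that inj by (auto dest: inj_onD)
  show ?thesis
  proof (rule partial_sums_le_of_row_col_transversal[OF p])
    show "\<phi> ` diagram q \<subseteq> diagram p" using \<phi>(1) by blast
    show "inj_on \<phi> (diagram q)" using eq by (rule inj_onI)
    fix d e assume de: "d \<in> diagram q" "e \<in> diagram q" "fst d = fst e" "snd (\<phi> d) = snd (\<phi> e)"
    show "d = e"
    proof (rule ccontr)
      assume "d \<noteq> e"
      then have "\<phi> d \<noteq> \<phi> e" using eq[OF de(1,2)] by blast
      then show False
        using transversal[of "\<phi> d" "\<phi> e" d e] \<phi>[OF de(1)] \<phi>[OF de(2)] de by simp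
    qed
  qed
qed

section \<open>Homomorphisms between Specht modules\<close>

context
  fixes f r and U V :: "(bitabloid \<Rightarrow>\<^sub>0 'k::field) set"
  assumes f: "f \<in> Hom_W r U V" and U: "free.subspace U"
begin

lemma Hom_W_add: "x \<in> U \<Longrightarrow> y \<in> U \<Longrightarrow> f (x + y) = f x + f y"
  using f by (simp add: Hom_W_def)

lemma Hom_W_zero: "f 0 = 0"
  using Hom_W_add[of 0 0] free.subspace_0[OF U] by simp

lemma Hom_W_uminus: "x \<in> U \<Longrightarrow> f (- x) = - f x"
  using Hom_W_add[of x "- x"] free.subspace_neg[OF U, of x] Hom_W_zero
  by (simp add: eq_neg_iff_add_eq_0 add.commute)

lemma Hom_W_act:
  assumes "x \<in> U" "\<sigma> \<in> carrier (hyperoct r)"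
  shows "f (act x (Poly_Mapping.single \<sigma> c)) = act (f x) (Poly_Mapping.single \<sigma> c)"
  using f assms by (auto simp: Hom_W_def group_algebra_def)

lemma Hom_W_fscale: "x \<in> U \<Longrightarrow> f (fscale c x) = fscale c (f x)"
  using Hom_W_act[of x "\<one>\<^bsub>hyperoct r\<^esub>" c] monoid.one_closed[OF group.is_monoid[OF hyperoct_group]]
  by (simp add: act_scalar)

lemma Hom_W_kernel: "free.subspace {x \<in> U. f x = 0}"
  using free.subspace_0[OF U] free.subspace_add[OF U] free.subspace_scale[OF U]
  by (intro free.subspaceI) (auto simp: Hom_W_zero Hom_W_add Hom_W_fscale)

end

text \<open>The two conditions on \<open>v\<close> are the relations satisfied by \<open>e\<^sub>t\<close> and inherited by its images. The
  tableau \<open>s0\<close> serves only to compare the sizes of the first components; the tableau \<open>s\<close>, coming from a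
  bi-tabloid in the support of \<open>v\<close>, carries the row and column conditions.\<close>

lemma dominates_of_col_antisymmetric:
  fixes v :: "bitabloid \<Rightarrow>\<^sub>0 'k::field"
  assumes two: "(2 :: 'k) \<noteq> 0"
    and l: "is_partition (fst l)" "is_partition (snd l)"
    and t: "t \<in> bitableaux r l" and v: "v \<in> Specht r m" "v \<noteq> 0"
    and odd: "\<And>\<sigma>. \<sigma> \<in> col_group r l t \<Longrightarrow> hsgn r \<sigma> = - 1 \<Longrightarrow> act v (group_elem \<sigma>) = - v"
    and inv: "\<And>a. a \<in> entries_snd l t \<Longrightarrow> act v (group_elem (sign_change a)) = v"
  shows "l \<unrhd> m"
proof -
  have "finite (entries_snd l t)" "entries_snd l t \<subseteq> {1..int r}"
    using entries_cover[OF t] by (auto simp: entries_snd_def finite_diagram)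
  from Specht_sign_change_invariant[OF two v(1) this inv]
  have span: "v \<in> free_span (polytabloid r m `
    {s \<in> bitableaux r m. entries_fst m s \<inter> entries_snd l t = {}})" .
  have "{s \<in> bitableaux r m. entries_fst m s \<inter> entries_snd l t = {}} \<noteq> {}"
  proof
    assume "{s \<in> bitableaux r m. entries_fst m s \<inter> entries_snd l t = {}} = {}"
    with span have "v \<in> free_span {}" by (simp only: image_empty)
    then show False using v(2) by simp
  qed
  then obtain s0 where s0: "s0 \<in> bitableaux r m" "entries_fst m s0 \<inter> entries_snd l t = {}" by blast
  obtain T where "Poly_Mapping.lookup v T \<noteq> 0" using v(2) poly_mapping_eqI[of v 0] by auto
  moreover from this have "T \<in> bitabloids r m"
    using subsetD[OF Specht_subset_perm_module v(1)] by (auto simp: perm_module_def in_keys_iff)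
  then obtain s where s: "s \<in> bitableaux r m" "T = tabloid r m s"
    by (auto simp: bitabloids_def tabloid_def elim: quotientE)
  ultimately have no_odd: False
    if "\<sigma> \<in> col_group r l t" "\<sigma> \<in> row_group r m s" "hsgn r \<sigma> = - 1" for \<sigma>
    using that lookup_antisym_fixed[OF two _ odd[OF that(1,3)], of r T] tabloid_row_group[OF s(1) that(2)]
    by (simp add: col_group_def tabloid_act_tabloid)
  have disj: "entries_fst l t \<inter> entries_snd m s = {}"
  proof (rule equals0I)
    fix a assume a: "a \<in> entries_fst l t \<inter> entries_snd m s"
    then have "a \<in> {1..int r}" using entries_cover[OF t] by blast
    then have abs: "\<bar>a\<bar> = a" "a \<in> signed_symbols r" by (auto simp: signed_symbols_def)
    then show False
      using a no_odd[of "sign_change a"] col_group_sign_change[OF t, of a]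
        row_group_sign_change[OF s(1), of a] hsgn_sign_change[of a r] by auto
  qed
  then have sub: "entries_fst l t \<subseteq> entries_fst m s"
    using entries_cover[OF t] entries_cover[OF s(1)] by blast
  have fin: "finite (entries_fst p u)" for p u by (simp add: entries_fst_def finite_diagram)
  have sub0: "entries_fst m s0 \<subseteq> entries_fst l t"
    using s0(2) entries_cover[OF t] entries_cover[OF s0(1)] by blast
  have "card (entries_fst m s) = card (entries_fst m s0)"
    by (simp add: card_entries_fst[OF s(1)] card_entries_fst[OF s0(1)])
  also have "\<dots> \<le> card (entries_fst l t)"
    by (rule card_mono[OF fin sub0])
  finally have eq: "entries_fst l t = entries_fst m s" using card_seteq[OF fin sub] by blast
  then have eq2: "entries_snd m s = entries_snd l t"
    using entries_cover[OF t] entries_cover[OF s(1)] entries_disjoint[OF t] entries_disjoint[OF s(1)] by blast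
  have fst_le: "sum_list (take j (fst m)) \<le> sum_list (take j (fst l))" for j
  proof (rule partial_sums_le_of_fillings[OF l(1)])
    show "(\<lambda>d. \<bar>s (Inl d)\<bar>) ` diagram (fst m) \<subseteq> (\<lambda>d. \<bar>t (Inl d)\<bar>) ` diagram (fst l)"
      using eq by (simp add: entries_fst_def)
    show "inj_on (\<lambda>d. \<bar>s (Inl d)\<bar>) (diagram (fst m))"
      using bitableau_entry_inj[OF s(1)] by (force intro!: inj_onI)
    fix d e d' e'
    assume d: "d \<in> diagram (fst l)" "e \<in> diagram (fst l)" "d \<noteq> e" "snd d = snd e"
      and d': "d' \<in> diagram (fst m)" "e' \<in> diagram (fst m)" "fst d' = fst e'"
      and eqs: "\<bar>s (Inl d')\<bar> = \<bar>t (Inl d)\<bar>" "\<bar>s (Inl e')\<bar> = \<bar>t (Inl e)\<bar>"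
    have ne: "\<bar>s (Inl d')\<bar> \<noteq> \<bar>s (Inl e')\<bar>"
      using bitableau_entry_inj[OF t, of "Inl d" "Inl e"] d eqs by auto
    \<comment> \<open>The signs are taken from \<open>s\<close>, whose rows in the first component may not change signs; the columns
      of \<open>t\<close> there may.\<close>
    show False
    proof (rule no_odd)
      show "signed_swap (s (Inl d')) (s (Inl e')) \<in> col_group r l t"
        by (rule col_group_signed_swap_fst[OF t d eqs])
      show "signed_swap (s (Inl d')) (s (Inl e')) \<in> row_group r m s"
        by (rule row_group_signed_swap_fst[OF s(1) d'(1,2) _ d'(3)]) (use ne in auto)
      show "hsgn r (signed_swap (s (Inl d')) (s (Inl e'))) = - 1"
        by (rule hsgn_signed_swap[OF _ _ ne]) (use bitableau_entry_symbol[OF s(1)] d' in auto)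
    qed
  qed
  have snd_le: "sum_list (take j (snd m)) \<le> sum_list (take j (snd l))" for j
  proof (rule partial_sums_le_of_fillings[OF l(2)])
    show "(\<lambda>d. \<bar>s (Inr d)\<bar>) ` diagram (snd m) \<subseteq> (\<lambda>d. \<bar>t (Inr d)\<bar>) ` diagram (snd l)"
      using eq2 by (simp add: entries_snd_def)
    show "inj_on (\<lambda>d. \<bar>s (Inr d)\<bar>) (diagram (snd m))"
      using bitableau_entry_inj[OF s(1)] by (force intro!: inj_onI)
    fix d e d' e'
    assume d: "d \<in> diagram (snd l)" "e \<in> diagram (snd l)" "d \<noteq> e" "snd d = snd e"
      and d': "d' \<in> diagram (snd m)" "e' \<in> diagram (snd m)" "fst d' = fst e'"
      and eqs: "\<bar>s (Inr d')\<bar> = \<bar>t (Inr d)\<bar>" "\<bar>s (Inr e')\<bar> = \<bar>t (Inr e)\<bar>"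
    have ne: "\<bar>t (Inr d)\<bar> \<noteq> \<bar>t (Inr e)\<bar>"
      using bitableau_entry_inj[OF t, of "Inr d" "Inr e"] d by auto
    \<comment> \<open>In the second component the roles are exchanged, so the signs are taken from \<open>t\<close>.\<close>
    show False
    proof (rule no_odd)
      show "signed_swap (t (Inr d)) (t (Inr e)) \<in> col_group r l t"
        by (rule col_group_signed_swap_snd[OF t d])
      show "signed_swap (t (Inr d)) (t (Inr e)) \<in> row_group r m s"
        by (rule row_group_signed_swap_snd[OF s(1) d'(1,2) _ d'(3)]) (use ne eqs in auto)
      show "hsgn r (signed_swap (t (Inr d)) (t (Inr e))) = - 1"
        by (rule hsgn_signed_swap[OF _ _ ne]) (use bitableau_entry_symbol[OF t] d in auto)
    qed
  qed
  have "sum_list (fst m) = card (entries_fst m s)" "sum_list (fst l) = card (entries_fst l t)"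
    by (simp_all add: card_entries_fst[OF s(1)] card_entries_fst[OF t] card_diagram)
  then have "sum_list (fst m) = sum_list (fst l)" using eq by simp
  then show ?thesis using fst_le snd_le by (simp add: dominates_def)
qed

lemma two_neq_zero:
  assumes "CHAR('k::idom) \<noteq> 2"
  shows "(2 :: 'k) \<noteq> 0"
proof
  assume "(2 :: 'k) = 0"
  then have "of_nat 2 = (0 :: 'k)" by simp
  then have "CHAR('k) dvd 2" by (simp only: of_nat_eq_0_iff_char_dvd)
  then have "CHAR('k) = 1 \<or> CHAR('k) = 2" using prime_nat_iff two_is_prime_nat by blast
  then show False using assms by simp
qed

theorem proposition2p8:
  fixes r :: nat and l m :: bipartition
  assumes "r \<ge> 1"
    and "CHAR('k::alg_closed_field) \<noteq> 2"
    and "l \<in> bipartitions r" and "m \<in> bipartitions r"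
    and "\<not> l \<unrhd> m"
  shows "Hom_W r (Specht r l :: (bitabloid \<Rightarrow>\<^sub>0 'k) set) (Specht r m) = {\<lambda>x. 0}"
proof (rule Set.set_eqI, unfold singleton_iff, rule iffI)
  fix f :: "(bitabloid \<Rightarrow>\<^sub>0 'k) \<Rightarrow> (bitabloid \<Rightarrow>\<^sub>0 'k)"
  assume "f = (\<lambda>x. 0)"
  then show "f \<in> Hom_W r (Specht r l) (Specht r m)"
    by (simp add: Hom_W_def Specht_def free.span_zero)
next
  fix f :: "(bitabloid \<Rightarrow>\<^sub>0 'k) \<Rightarrow> (bitabloid \<Rightarrow>\<^sub>0 'k)"
  assume f: "f \<in> Hom_W r (Specht r l) (Specht r m)"
  have two: "(2 :: 'k) \<noteq> 0" by (rule two_neq_zero[OF assms(2)])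
  have l: "is_partition (fst l)" "is_partition (snd l)"
    using assms(3) by (auto simp: bipartitions_def)
  have sub: "free.subspace (Specht r l :: (bitabloid \<Rightarrow>\<^sub>0 'k) set)" by (simp add: Specht_def)
  have gen: "f (polytabloid r l t) = 0" if t: "t \<in> bitableaux r l" for t
  proof (rule ccontr)
    assume nz: "f (polytabloid r l t) \<noteq> 0"
    have et: "(polytabloid r l t :: bitabloid \<Rightarrow>\<^sub>0 'k) \<in> Specht r l" using t by (auto simp: Specht_def intro: free.span_base)
    have "l \<unrhd> m"
    proof (rule dominates_of_col_antisymmetric[OF two l t _ nz])
      show "f (polytabloid r l t) \<in> Specht r m" using f et by (simp add: Hom_W_def)
      show "act (f (polytabloid r l t)) (group_elem \<sigma>) = - f (polytabloid r l t)"
        if "\<sigma> \<in> col_group r l t" "hsgn r \<sigma> = - 1" for \<sigma>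
        using Hom_W_act[OF f sub et, of \<sigma> 1] Hom_W_uminus[OF f sub et] polytabloid_odd[OF that, where 'k = 'k] that(1)
        by (simp add: col_group_def)
      show "act (f (polytabloid r l t)) (group_elem (sign_change a)) = f (polytabloid r l t)"
        if a: "a \<in> entries_snd l t" for a
      proof -
        have "a \<in> {1..int r}" using a entries_cover[OF t] by blast
        then have abs: "\<bar>a\<bar> = a" and "a \<in> signed_symbols r" by (auto simp: signed_symbols_def)
        then show ?thesis
          using Hom_W_act[OF f sub et sign_change_hyperoct, of a 1]
            polytabloid_sign_change_snd[OF t, of a, where 'k = 'k] a by simp
      qed
    qed
    then show False using assms(5) by simp
  qed
  have "Specht r l \<subseteq> {x \<in> Specht r l. f x = 0}"
    by (subst Specht_def, rule free.span_minimal[OF _ Hom_W_kernel[OF f sub]])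
      (use gen in \<open>auto simp: Specht_def intro: free.span_base\<close>)
  moreover have "f x = 0" if "x \<notin> Specht r l" for x using f that by (simp add: Hom_W_def)
  ultimately show "f = (\<lambda>x. 0)" by blast
qed

end
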